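(* The minimum problem $$\min_{h\in \mathcal{P}_1}\sigma_1(h)$$ admits the functions $T_0(x)=2(1-x)$ and $T_1(x)=2x$ as its unique solutions; that is, the minimum is attained, and a function $h\in\mathcal{P}_1$ is a minimizer if and only if $h=T_0$ or $h=T_1$.
   Context: Let $\mathcal{P}$ be the set of functions $h\in L^\infty(0,1)$ that are non-negative, concave and not identically zero (each such $h$ is identified with its continuous representative on $[0,1]$), and let $\mathcal{P}_1=\{h\in\mathcal{P} : \int_0^1 h(t)\,dt=1\}$. For $h\in\mathcal{P}$ define $$\sigma_1(h)=\inf\left\{\frac{\int_0^1 (v')^2 h\,dx}{\int_0^1 v^2\,dx} : v\in H^1(0,1),\ v\neq 0,\ \int_0^1 v\,dx=0\right\}.$$ This is the first non-zero eigenvalue of the Sturm–Liouville problem $-(h v')'=\sigma v$ in $(0,1)$, $h(0)v'(0)=h(1)v'(1)=0$. *)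

theory Defs
  imports "HOL-Analysis.Analysis"
begin

abbreviation unit_measure :: "real measure" where
  "unit_measure \<equiv> lebesgue_on {0<..<1}"

definition L2 :: "(real \<Rightarrow> real) set" where
  "L2 = {v \<in> borel_measurable unit_measure. integrable unit_measure (\<lambda>x. (v x)\<^sup>2)}"

text \<open>The space \<open>C\<^sub>c\<^sup>1(0,1)\<close>, with functions extended by zero to the whole line.\<close>

definition test_functions :: "(real \<Rightarrow> real) set" where
  "test_functions = {\<phi>. \<phi> C1_differentiable_on UNIV \<and>
     compact (closure {x. \<phi> x \<noteq> 0}) \<and> closure {x. \<phi> x \<noteq> 0} \<subseteq> {0<..<1}}"

definition has_weak_derivative :: "(real \<Rightarrow> real) \<Rightarrow> (real \<Rightarrow> real) \<Rightarrow> bool"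
    (infix "has'_weak'_derivative" 50) where
  "v has_weak_derivative g \<longleftrightarrow>
     (\<forall>\<phi>\<in>test_functions.
        (LINT x|unit_measure. v x * deriv \<phi> x) = - (LINT x|unit_measure. g x * \<phi> x))"

text \<open>The Sobolev space \<open>H\<^sup>1(0,1)\<close>, defined by weak derivatives tested against
  \<open>C\<^sub>c\<^sup>1(0,1)\<close>, as in Brezis, Functional Analysis, Sobolev Spaces and Partial
  Differential Equations, Section 8.2. Its members are functions rather than classes
  modulo null sets.\<close>

definition H1 :: "(real \<Rightarrow> real) set" where
  "H1 = {v \<in> L2. \<exists>g\<in>L2. v has_weak_derivative g}"

text \<open>Each \<open>h\<close> is given by its continuous representative, so boundedness on the unit
  interval is implied; values outside \<open>[0,1]\<close> are irrelevant.\<close>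

definition profiles :: "(real \<Rightarrow> real) set" where
  "profiles = {h. continuous_on {0..1} h \<and> concave_on {0..1} h \<and>
     (\<forall>x\<in>{0..1}. 0 \<le> h x) \<and> (\<exists>x\<in>{0..1}. h x \<noteq> 0)}"

definition profiles1 :: "(real \<Rightarrow> real) set" where
  "profiles1 = {h \<in> profiles. (LINT x|unit_measure. h x) = 1}"

text \<open>The weak derivative \<open>v'\<close> is determined by \<open>v\<close> up to a null set, so quantifying over
  all its representatives does not change the set of quotients. The condition \<open>v \<noteq> 0\<close> is
  meant in \<open>H\<^sup>1\<close>, that is, modulo null sets.\<close>

definition sigma1 :: "(real \<Rightarrow> real) \<Rightarrow> real" where
  "sigma1 h = Inf {(LINT x|unit_measure. (v' x)\<^sup>2 * h x) / (LINT x|unit_measure. (v x)\<^sup>2) | v v'.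
     v \<in> H1 \<and> v' \<in> L2 \<and> v has_weak_derivative v' \<and>
     \<not> (AE x in unit_measure. v x = 0) \<and> (LINT x|unit_measure. v x) = 0}"

definition T0 :: "real \<Rightarrow> real" where
  "T0 x = 2 * (1 - x)"

definition T1 :: "real \<Rightarrow> real" where
  "T1 x = 2 * x"

end

theory Submission
  imports Defs
begin

text \<open>
  The problem is dualised. For \<open>v\<close> of mean zero put \<open>w = \<integral> v\<close>, which vanishes at both ends. Since
  \<open>\<integral> v\<^sup>2 = - \<integral> v' w\<close>, the bound \<open>\<sigma>\<^sub>1(h) \<ge> 1 / C\<close> follows from the weighted inequality
  \<open>\<integral> w\<^sup>2 / h \<le> C \<integral> w'\<^sup>2\<close> (\<open>poincare\<close>, \<open>rayleigh_quotient_ge\<close>). The left-hand side is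
  convex in \<open>h\<close>, so such inequalities pass to mixtures of profiles with averaged constants
  (\<open>poincare_mixture\<close>), and every concave profile is a limit of mixtures of tents, the
  functions that rise linearly from \<open>0\<close> to \<open>2\<close> at a peak \<open>a\<close> and fall linearly back to \<open>0\<close>
  (\<open>concave_tent_approximation\<close>). The end cases \<open>a = 0\<close> and \<open>a = 1\<close> are \<open>T0\<close> and \<open>T1\<close>, and
  the task is to show that they have the worst constant.

  For a tent the dual equation \<open>- w'' = \<sigma> w / h\<close> is a Bessel equation on either side of the peak.
  With \<open>f x = J\<^sub>0(2 \<surd>x)\<close> and \<open>g x = J\<^sub>1(2 \<surd>x) / \<surd>x\<close> the solutions are multiples of \<open>y g y\<close>
  where \<open>y\<close> is a multiple of the distance to the end point of the branch. Let \<open>c\<close> be the first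
  zero of \<open>g\<close>; the constant for \<open>T0\<close> and \<open>T1\<close> is \<open>1 / (2 c)\<close>, attained for \<open>T1\<close> by
  \<open>v x = f(c x)\<close> and for \<open>T0\<close> by its reflection.

  For a peak in the interior Jacobi's method yields an inequality with constant
  \<open>1 / (2 k)\<close> as soon as the logarithmic derivatives of the two solutions with parameter \<open>k\<close>
  jump in the right direction at the peak (\<open>poincare_tent\<close>). At \<open>k = c\<close> the jump is strictly of
  the right sign because \<open>f / g\<close> is decreasing (\<open>slope_jump_pos\<close>), so on compact sets of
  peaks some \<open>k > c\<close> is admissible.

  Uniqueness comes from the midpoint value. Each tent has \<open>tent a (1 / 2) \<ge> 1\<close>, with equality only
  for \<open>T0\<close> and \<open>T1\<close>. If \<open>h (1 / 2) > 1\<close>, the mixtures approximating \<open>h\<close> keep a fixed mass on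
  interior peaks and the constant of \<open>h\<close> is strictly better (\<open>poincare_concave_midpoint\<close>). If
  \<open>h (1 / 2) = 1\<close>, then \<open>h\<close> is affine; unless it is \<open>T0\<close> or \<open>T1\<close>, it is a mixture of one of
  them with the constant profile, whose constant is strictly better because \<open>2 c \<le> 8 < \<pi>\<^sup>2\<close>
  (\<open>poincare_affine\<close>).
\<close>

section \<open>Bessel functions as entire functions\<close>

text \<open>\<open>J\<^sub>0(2 \<surd>x)\<close> and \<open>J\<^sub>1(2 \<surd>x) / \<surd>x\<close>: in this variable the
  functions are entire and no square roots enter. They are called \<open>f\<close> and \<open>g\<close> in the comments.\<close>

definition bessel0 :: "real \<Rightarrow> real" where
  "bessel0 x = (\<Sum>n. (-1)^n / (fact n)\<^sup>2 * x^n)"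

definition bessel1 :: "real \<Rightarrow> real" where
  "bessel1 x = (\<Sum>n. (-1)^n / (fact n * fact (Suc n)) * x^n)"

lemma summable_bessel0: "summable (\<lambda>n. (-1)^n / (fact n)\<^sup>2 * x^n :: real)"
proof (rule summable_comparison_test')
  show "summable (\<lambda>n. \<bar>x\<bar>^n / fact n)"
    using summable_exp[of "\<bar>x\<bar>"] by (simp add: field_simps)
  show "norm ((-1)^n / (fact n)\<^sup>2 * x^n) \<le> \<bar>x\<bar>^n / fact n" for n
  proof -
    have "(fact n :: real) \<le> (fact n)\<^sup>2"
      using fact_ge_1[of n, where 'a=real] by (simp add: power2_eq_square)
    then have "\<bar>x\<bar>^n / (fact n)\<^sup>2 \<le> \<bar>x\<bar>^n / fact n"
      by (intro divide_left_mono) auto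
    then show ?thesis by (simp add: abs_mult power_abs)
  qed
qed

lemma summable_bessel1: "summable (\<lambda>n. (-1)^n / (fact n * fact (Suc n)) * x^n :: real)"
proof (rule summable_comparison_test')
  show "summable (\<lambda>n. \<bar>x\<bar>^n / fact n)"
    using summable_exp[of "\<bar>x\<bar>"] by (simp add: field_simps)
  show "norm ((-1)^n / (fact n * fact (Suc n)) * x^n) \<le> \<bar>x\<bar>^n / fact n" for n
  proof -
    have "(fact n :: real) * 1 \<le> fact n * fact (Suc n)"
      using fact_ge_1[of "Suc n", where 'a=real] by (intro mult_left_mono) auto
    then have "\<bar>x\<bar>^n / (fact n * fact (Suc n)) \<le> \<bar>x\<bar>^n / fact n"
      by (intro divide_left_mono) auto
    then show ?thesis by (simp add: abs_mult power_abs del: fact_Suc)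
  qed
qed

lemma bessel0_0 [simp]: "bessel0 0 = 1" and bessel1_0 [simp]: "bessel1 0 = 1"
  unfolding bessel0_def bessel1_def
  using powser_zero[of "\<lambda>n. (-1)^n / (fact n)\<^sup>2 :: real"]
    powser_zero[of "\<lambda>n. (-1)^n / (fact n * fact (Suc n)) :: real"] by simp_all

lemma DERIV_bessel0: "(bessel0 has_real_derivative - bessel1 x) (at x)"
proof -
  have d: "diffs (\<lambda>n. (-1)^n / (fact n)\<^sup>2 :: real) n = - ((-1)^n / (fact n * fact (Suc n)))" for n
    by (simp add: diffs_def power2_eq_square field_simps del: of_nat_Suc)
  show ?thesis
    using termdiffs_strong_converges_everywhere[OF summable_bessel0, of x]
    unfolding d mult_minus_left suminf_minus[OF summable_bessel1]
    by (simp only: bessel0_def[abs_def] bessel1_def)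
qed

text \<open>Bessel's equation as a first-order system: \<open>f' = -g\<close> and \<open>(x g)' = f\<close>. Hence
  \<open>u = x g\<close> solves \<open>-u'' = u / x\<close>, the dual equation for the linear profile.\<close>

lemma DERIV_mult_bessel1: "((\<lambda>x. x * bessel1 x) has_real_derivative bessel0 x) (at x)"
proof -
  define a :: "nat \<Rightarrow> real" where "a n = (case n of 0 \<Rightarrow> 0 | Suc k \<Rightarrow> (-1)^k / (fact k * fact n))" for n
  have aS: "a (Suc n) * y ^ Suc n = y * ((-1)^n / (fact n * fact (Suc n)) * y^n)" for y n
    by (simp add: a_def)
  have sums: "(\<lambda>n. a n * y^n) sums (y * bessel1 y)" for y
  proof -
    have "(\<lambda>n. a (Suc n) * y ^ Suc n) sums (y * bessel1 y)"
      unfolding aS bessel1_def by (intro sums_mult summable_sums summable_bessel1)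
    then show ?thesis
      using sums_Suc_iff[of "\<lambda>n. a n * y^n" "y * bessel1 y"] by (simp add: a_def)
  qed
  have d: "diffs a n = (-1)^n / (fact n)\<^sup>2" for n
    by (simp add: a_def diffs_def power2_eq_square field_simps del: of_nat_Suc)
  have "((\<lambda>y. \<Sum>n. a n * y^n) has_real_derivative (\<Sum>n. diffs a n * x^n)) (at x)"
    using termdiffs_strong_converges_everywhere[OF sums_summable[OF sums]] .
  then show ?thesis
    unfolding d using sums_unique[OF sums, symmetric] by (simp add: bessel0_def)
qed

lemma DERIV_bessel1:
  assumes "x \<noteq> 0"
  shows "(bessel1 has_real_derivative (bessel0 x - bessel1 x) / x) (at x)"
proof -
  have "((\<lambda>y. y * bessel1 y / y) has_real_derivative (bessel0 x - bessel1 x) / x) (at x)"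
    by (rule DERIV_cong[OF DERIV_divide[OF DERIV_mult_bessel1 DERIV_ident assms]])
      (use assms in \<open>simp add: field_simps\<close>)
  moreover have "\<forall>\<^sub>F y in nhds x. y * bessel1 y / y = bessel1 y"
    using t1_space_nhds[OF assms] by (rule eventually_mono) auto
  ultimately show ?thesis
    using DERIV_cong_ev[of x x "\<lambda>y. y * bessel1 y / y" bessel1] by blast
qed

lemma DERIV_bessel0_scaled:
  "((\<lambda>y. bessel0 (\<beta> * y)) has_real_derivative - \<beta> * bessel1 (\<beta> * x)) (at x within S)"
  by (rule DERIV_cong[OF DERIV_chain'[OF _ DERIV_bessel0]]) (auto intro!: derivative_eq_intros)

lemma DERIV_mult_bessel1_scaled:
  "((\<lambda>y. y * bessel1 (\<beta> * y)) has_real_derivative bessel0 (\<beta> * x)) (at x within S)"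
proof (cases "\<beta> = 0")
  case False
  have "((\<lambda>y. (\<beta> * y) * bessel1 (\<beta> * y)) has_real_derivative bessel0 (\<beta> * x) * \<beta>) (at x within S)"
    by (rule DERIV_chain'[OF _ DERIV_mult_bessel1]) (auto intro!: derivative_eq_intros)
  from DERIV_cdivide[OF this, of \<beta>] False show ?thesis by simp
qed (auto intro!: derivative_eq_intros)

lemma continuous_on_bessel0 [continuous_intros]:
  assumes "continuous_on A k" shows "continuous_on A (\<lambda>x. bessel0 (k x))"
proof -
  have "continuous_on UNIV bessel0"
    using DERIV_bessel0 DERIV_isCont by (blast intro: continuous_at_imp_continuous_on)
  from continuous_on_compose2[OF this assms] show ?thesis by simp
qed

lemma continuous_on_bessel1 [continuous_intros]:
  assumes "continuous_on A k" shows "continuous_on A (\<lambda>x. bessel1 (k x))"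
proof -
  have "continuous_on UNIV bessel1"
    using isCont_powser_converges_everywhere[OF summable_bessel1]
    by (auto simp: bessel1_def[abs_def] intro!: continuous_at_imp_continuous_on)
  from continuous_on_compose2[OF this assms] show ?thesis by simp
qed

section \<open>The half-interval inequality\<close>

text \<open>A \<open>C\<^sup>1\<close> function vanishing at \<open>0\<close> is \<open>O(x)\<close>, which tames the weight \<open>1 / x\<close>.\<close>

lemma DERIV_at_zero_bound:
  fixes w V :: "real \<Rightarrow> real"
  assumes "0 \<le> a"
    and w: "\<And>x. x \<in> {0..a} \<Longrightarrow> (w has_real_derivative V x) (at x within {0..a})"
    and V: "continuous_on {0..a} V" and "w 0 = 0"
  obtains K where "0 \<le> K" "\<And>x. x \<in> {0..a} \<Longrightarrow> \<bar>w x\<bar> \<le> K * x"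
proof -
  have "compact (V ` {0..a})" using V by (intro compact_continuous_image) auto
  then obtain K where K: "\<And>x. x \<in> {0..a} \<Longrightarrow> \<bar>V x\<bar> \<le> K"
    using compact_imp_bounded bounded_iff by (metis image_eqI real_norm_def)
  have "K \<ge> 0" using K[of 0] \<open>0 \<le> a\<close> by auto
  moreover have "\<bar>w x\<bar> \<le> K * x" if "x \<in> {0..a}" for x
  proof -
    have "norm (w x - w 0) \<le> K * norm (x - 0)"
      using that K by (intro field_differentiable_bound[OF _ w]) auto
    then show ?thesis using that \<open>w 0 = 0\<close> by simp
  qed
  ultimately show thesis using that by blast
qed

lemma continuous_on_sq_div:
  fixes w V :: "real \<Rightarrow> real"
  assumes "0 \<le> a"
    and w: "\<And>x. x \<in> {0..a} \<Longrightarrow> (w has_real_derivative V x) (at x within {0..a})"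
    and V: "continuous_on {0..a} V" and "w 0 = 0"
  shows "continuous_on {0..a} (\<lambda>x. (w x)\<^sup>2 / x)"
proof -
  obtain K where K: "0 \<le> K" "\<And>x. x \<in> {0..a} \<Longrightarrow> \<bar>w x\<bar> \<le> K * x"
    using DERIV_at_zero_bound[OF assms] by blast
  have cw: "continuous_on {0..a} w" using w DERIV_continuous_on by blast
  show ?thesis
    unfolding continuous_on_eq_continuous_within
  proof
    fix x assume x: "x \<in> {0..a}"
    show "continuous (at x within {0..a}) (\<lambda>x. (w x)\<^sup>2 / x)"
    proof (cases "x = 0")
      case False
      then show ?thesis using x cw
        by (auto simp: continuous_on_eq_continuous_within intro!: continuous_intros)
    next
      case True
      have "((\<lambda>x. (w x)\<^sup>2 / x) \<longlongrightarrow> 0) (at 0 within {0..a})"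
      proof (rule Lim_null_comparison)
        have "norm ((w y)\<^sup>2 / y) \<le> K\<^sup>2 * y" if y: "y \<in> {0..a}" for y
        proof -
          have "(w y)\<^sup>2 \<le> (K * y)\<^sup>2" using K(2)[OF y] by (metis abs_ge_zero power2_abs power_mono)
          then show ?thesis using y by (cases "y = 0") (auto simp: field_simps power2_eq_square)
        qed
        then show "\<forall>\<^sub>F y in at 0 within {0..a}. norm ((w y)\<^sup>2 / y) \<le> K\<^sup>2 * y"
          by (auto simp: eventually_at_filter)
        show "((\<lambda>y. K\<^sup>2 * y) \<longlongrightarrow> 0) (at 0 within {0..a})"
          by (auto intro!: tendsto_eq_intros)
      qed
      then show ?thesis using True by (simp add: continuous_within)
    qed
  qed
qed

text \<open>Jacobi's method for the weight \<open>1 / x\<close>: with \<open>u x = x g(\<beta> x)\<close>, a positive solution of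
  \<open>-u'' = \<beta> u / x\<close>, the function \<open>q = -u' / u\<close> satisfies \<open>q' = \<beta> / x + q\<^sup>2\<close>, and
  \<open>0 \<le> (w' + q w)\<^sup>2 = w'\<^sup>2 + (q w\<^sup>2)' - \<beta> w\<^sup>2 / x\<close> is integrated. The end point \<open>a\<close> is
  left free because two such intervals are glued at the peak of a tent.\<close>

lemma half_interval_inequality:
  fixes w V :: "real \<Rightarrow> real"
  assumes "0 < a" "0 \<le> \<beta>"
    and w: "\<And>x. x \<in> {0..a} \<Longrightarrow> (w has_real_derivative V x) (at x within {0..a})"
    and V: "continuous_on {0..a} V" and "w 0 = 0"
    and pos: "\<And>z. z \<in> {0..\<beta> * a} \<Longrightarrow> 0 < bessel1 z"
  shows "\<beta> * integral {0..a} (\<lambda>x. (w x)\<^sup>2 / x) + bessel0 (\<beta> * a) / (a * bessel1 (\<beta> * a)) * (w a)\<^sup>2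
    \<le> integral {0..a} (\<lambda>x. (V x)\<^sup>2)"
proof -
  \<comment> \<open>\<open>S = q w\<^sup>2\<close>, written so that it is continuous at \<open>0\<close>, where division by zero gives \<open>S 0 = 0\<close>.\<close>
  define S where "S = (\<lambda>x. - (bessel0 (\<beta> * x) / bessel1 (\<beta> * x)) * ((w x)\<^sup>2 / x))"
  define q where "q = (\<lambda>x. - (bessel0 (\<beta> * x) / (x * bessel1 (\<beta> * x))))"
  define S' where "S' = (\<lambda>x. 2 * q x * w x * V x + (\<beta> / x + (q x)\<^sup>2) * (w x)\<^sup>2)"
  have pos': "0 < bessel1 (\<beta> * x)" if "x \<in> {0..a}" for x
    using that \<open>0 \<le> \<beta>\<close> by (intro pos) (auto intro: mult_left_mono)
  have cd: "continuous_on {0..a} (\<lambda>x. (w x)\<^sup>2 / x)"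
    using assms by (intro continuous_on_sq_div) auto
  have cS: "continuous_on {0..a} S"
    unfolding S_def using pos'
    by (intro continuous_intros cd) (auto simp: less_imp_neq[THEN not_sym])
  have q': "(q has_real_derivative \<beta> / x + (q x)\<^sup>2) (at x)" if "x \<in> {0<..<a}" for x
  proof -
    have n: "bessel1 (\<beta> * x) \<noteq> 0" "x \<noteq> 0" using pos'[of x] that by auto
    show ?thesis
      unfolding q_def
      by (rule DERIV_cong[OF DERIV_minus[OF DERIV_divide[OF DERIV_bessel0_scaled DERIV_mult_bessel1_scaled]]])
        (use n in \<open>auto simp: field_simps power2_eq_square\<close>)
  qed
  have "(S' has_integral (S a - S 0)) {0..a}"
  proof (rule fundamental_theorem_of_calculus_interior)
    fix x assume x: "x \<in> {0<..<a}"
    have wx: "(w has_real_derivative V x) (at x)"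
      using w[of x] x at_within_interior[of x "{0..a}"] by (simp add: interior_atLeastAtMost_real)
    have "((\<lambda>y. q y * (w y)\<^sup>2) has_real_derivative S' x) (at x)"
      unfolding S'_def
      by (rule derivative_eq_intros q'[OF x] wx refl)+ (simp add: algebra_simps)
    then show "(S has_vector_derivative S' x) (at x)"
      unfolding q_def S_def has_real_derivative_iff_has_vector_derivative by (simp add: field_simps)
  qed (use \<open>0 < a\<close> cS in auto)
  moreover have "S 0 = 0" by (simp add: S_def)
  ultimately have S': "(S' has_integral S a) {0..a}" by simp
  have i1: "(\<lambda>x. (w x)\<^sup>2 / x) integrable_on {0..a}" by (intro integrable_continuous_real cd)
  have i2: "(\<lambda>x. (V x)\<^sup>2) integrable_on {0..a}"
    by (intro integrable_continuous_real continuous_intros V)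
  have "((\<lambda>x. (V x)\<^sup>2 + S' x - \<beta> * ((w x)\<^sup>2 / x)) has_integral
     (integral {0..a} (\<lambda>x. (V x)\<^sup>2) + S a - \<beta> * integral {0..a} (\<lambda>x. (w x)\<^sup>2 / x))) {0..a}"
    by (intro has_integral_diff has_integral_add has_integral_mult_right S' integrable_integral i1 i2)
  moreover have "0 \<le> (V x)\<^sup>2 + S' x - \<beta> * ((w x)\<^sup>2 / x)" for x
  proof -
    have "(V x)\<^sup>2 + S' x - \<beta> * ((w x)\<^sup>2 / x) = (V x + q x * w x)\<^sup>2"
      unfolding S'_def by (simp add: power2_eq_square algebra_simps)
    then show ?thesis by simp
  qed
  ultimately have "0 \<le> integral {0..a} (\<lambda>x. (V x)\<^sup>2) + S a - \<beta> * integral {0..a} (\<lambda>x. (w x)\<^sup>2 / x)"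
    by (rule has_integral_nonneg)
  then show ?thesis by (simp add: S_def mult.commute)
qed

section \<open>The first zero\<close>

text \<open>The half-interval inequality bounds its own parameter: the trial function \<open>x (1 - x)\<close>
  yields \<open>\<beta> / 12 \<le> 1 / 3\<close>. So \<open>g\<close> has a zero in \<open>(0, 4]\<close>, located without evaluating its series.\<close>

lemma bessel1_positive_interval_bounded:
  assumes "0 \<le> \<beta>" and pos: "\<And>z. z \<in> {0..\<beta>} \<Longrightarrow> 0 < bessel1 z"
  shows "\<beta> \<le> 4"
proof -
  have d: "((\<lambda>x::real. x * (1 - x)) has_real_derivative 1 - 2 * x) (at x within {0..1})" for x
    by (auto intro!: derivative_eq_intros)
  have "\<beta> * integral {0..1} (\<lambda>x. (x * (1 - x))\<^sup>2 / x)
      + bessel0 (\<beta> * 1) / (1 * bessel1 (\<beta> * 1)) * (1 * (1 - 1))\<^sup>2 \<le> integral {0..1} (\<lambda>x. (1 - 2 * x)\<^sup>2)"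
    by (rule half_interval_inequality[OF _ assms(1) d]) (use pos in \<open>auto intro!: continuous_intros\<close>)
  moreover have "integral {0..1} (\<lambda>x::real. (x * (1 - x))\<^sup>2 / x) = 1 / 12"
  proof -
    have "((\<lambda>x::real. x * (1 - x)\<^sup>2) has_integral
        (1^2/2 - 2*1^3/3 + 1^4/4 - (0^2/2 - 2*0^3/3 + 0^4/4))) {0..1}"
      by (intro fundamental_theorem_of_calculus)
        (auto intro!: derivative_eq_intros simp: has_real_derivative_iff_has_vector_derivative[symmetric] power2_eq_square power3_eq_cube algebra_simps)
    moreover have "(x * (1 - x))\<^sup>2 / x = x * (1 - x)\<^sup>2" for x :: real
      by (simp add: power2_eq_square)
    ultimately show ?thesis by (simp add: integral_unique)
  qed
  moreover have "integral {0..1} (\<lambda>x::real. (1 - 2 * x)\<^sup>2) = 1 / 3"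
  proof -
    have "((\<lambda>x::real. (1 - 2 * x)\<^sup>2) has_integral (1 - 2 * 1^2 + 4 * 1^3/3 - (0 - 2 * 0^2 + 4 * 0^3/3))) {0..1}"
      by (intro fundamental_theorem_of_calculus)
        (auto intro!: derivative_eq_intros simp: has_real_derivative_iff_has_vector_derivative[symmetric] power2_eq_square algebra_simps)
    then show ?thesis by (simp add: integral_unique)
  qed
  ultimately show ?thesis by simp
qed

lemma first_zero_bessel1_exists:
  "\<exists>c>0. c \<le> 4 \<and> bessel1 c = 0 \<and> (\<forall>z. 0 \<le> z \<longrightarrow> z < c \<longrightarrow> 0 < bessel1 z)"
proof -
  define Z where "Z = {z \<in> {0..5}. bessel1 z \<le> 0}"
  have "Z \<noteq> {}"
    using bessel1_positive_interval_bounded[of 5] by (fastforce simp: Z_def not_le[symmetric])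
  moreover have "closed Z"
    unfolding Z_def by (intro continuous_on_closed_Collect_le continuous_intros closed_atLeastAtMost)
  moreover have "bounded Z"
    by (rule bounded_subset[OF bounded_closed_interval[of 0 5]]) (auto simp: Z_def)
  ultimately have cZ: "compact Z" "Z \<noteq> {}"
    by (auto simp: compact_eq_bounded_closed)
  obtain c where c: "c \<in> Z" "\<And>z. z \<in> Z \<Longrightarrow> c \<le> z"
    using compact_attains_inf[OF cZ] by blast
  have pos: "0 < bessel1 z" if "0 \<le> z" "z < c" for z
    using c that by (force simp: Z_def not_le)
  have "c \<noteq> 0" using c(1) by (auto simp: Z_def)
  then have "0 < c" using c(1) by (auto simp: Z_def)
  moreover have "c \<le> 4"
  proof (rule dense_le_bounded[of 0 c])
    show "\<beta> \<le> 4" if "0 < \<beta>" "\<beta> < c" for \<beta>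
      using that pos by (intro bessel1_positive_interval_bounded) auto
  qed (fact \<open>0 < c\<close>)
  moreover have "bessel1 c = 0"
  proof (rule antisym)
    show "bessel1 c \<le> 0" using c(1) by (simp add: Z_def)
    have "continuous_on {0..c} bessel1" by (rule continuous_on_bessel1) (rule continuous_on_id)
    then have "((bessel1) \<longlongrightarrow> bessel1 c) (at c within {0..c})"
      using \<open>0 < c\<close> by (auto simp: continuous_on_def)
    then have "(bessel1 \<longlongrightarrow> bessel1 c) (at_left c)"
      using \<open>0 < c\<close> by (simp add: at_within_Icc_at_left)
    moreover have "\<forall>\<^sub>F z in at_left c. 0 \<le> bessel1 z"
      using eventually_at_left_real[OF \<open>0 < c\<close>] by eventually_elim (simp add: less_imp_le pos)
    ultimately show "0 \<le> bessel1 c" by (rule tendsto_lowerbound) simp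
  qed
  ultimately show ?thesis using pos by blast
qed

text \<open>The number \<open>j\<^sup>2 / 4\<close>, where \<open>j\<close> is the first positive zero of \<open>J\<^sub>1\<close>; the minimal
  eigenvalue is \<open>2 bessel_zero = j\<^sup>2 / 2\<close>. It is called \<open>c\<close> in the comments.\<close>

definition bessel_zero :: real where
  "bessel_zero = (SOME c. 0 < c \<and> c \<le> 4 \<and> bessel1 c = 0 \<and> (\<forall>z. 0 \<le> z \<longrightarrow> z < c \<longrightarrow> 0 < bessel1 z))"

lemma bessel_zero:
  "0 < bessel_zero" "bessel_zero \<le> 4" "bessel1 bessel_zero = 0"
  "\<And>z. 0 \<le> z \<Longrightarrow> z < bessel_zero \<Longrightarrow> 0 < bessel1 z"
  using someI_ex[OF first_zero_bessel1_exists, folded bessel_zero_def] by blast+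

text \<open>\<open>(z (f - g))' = - z g < 0\<close> up to the first zero of \<open>g\<close>.\<close>

lemma bessel0_less_bessel1:
  assumes "0 < z" "z \<le> bessel_zero" shows "bessel0 z < bessel1 z"
proof -
  define k where "k y = y * (bessel0 y - bessel1 y)" for y
  have "k z < k 0"
  proof (rule DERIV_neg_imp_decreasing_open[OF \<open>0 < z\<close>])
    fix y assume y: "0 < y" "y < z"
    have "(k has_real_derivative - y * bessel1 y) (at y)"
      unfolding k_def using y
      by (auto intro!: derivative_eq_intros DERIV_bessel0 DERIV_bessel1 simp: field_simps)
    moreover have "- y * bessel1 y < 0" using bessel_zero(4)[of y] y assms by simp
    ultimately show "\<exists>d. (k has_real_derivative d) (at y) \<and> d < 0" by blast
  qed (auto simp: k_def intro!: continuous_intros)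
  then show ?thesis using assms by (simp add: k_def mult_less_0_iff)
qed

lemma bessel0_antimono:
  assumes "0 \<le> x" "x < y" "y \<le> bessel_zero" shows "bessel0 y < bessel0 x"
proof (rule DERIV_neg_imp_decreasing_open[OF \<open>x < y\<close>])
  show "\<exists>d. (bessel0 has_real_derivative d) (at t) \<and> d < 0" if "x < t" "t < y" for t
    using DERIV_bessel0[of t] bessel_zero(4)[of t] that assms by fastforce
qed (auto intro!: continuous_intros)

text \<open>This expression is \<open>- z g\<^sup>2 (f / g)'\<close>. It is clearly positive where \<open>f \<le> 0\<close>; as long as
  \<open>f > 0\<close> it grows from \<open>0\<close>, its derivative being \<open>f (g - f) / z\<close>.\<close>

lemma bessel_quotient_slope_sign:
  assumes "0 < z" "z \<le> bessel_zero"
  shows "0 < z * (bessel1 z)\<^sup>2 + (bessel0 z)\<^sup>2 - bessel0 z * bessel1 z"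
proof (cases "bessel0 z \<le> 0")
  case True
  have "0 \<le> bessel1 z" using bessel_zero(3) bessel_zero(4)[of z] assms by (cases "z = bessel_zero") auto
  then have "bessel0 z * bessel1 z \<le> 0" using True by (simp add: mult_le_0_iff)
  moreover have "0 < z * (bessel1 z)\<^sup>2 + (bessel0 z)\<^sup>2"
    using bessel0_less_bessel1[OF assms] assms
    by (cases "bessel0 z = 0") (auto intro!: add_pos_nonneg add_nonneg_pos)
  ultimately show ?thesis by linarith
next
  case False
  define N where "N = (\<lambda>y. y * (bessel1 y)\<^sup>2 + (bessel0 y)\<^sup>2 - bessel0 y * bessel1 y)"
  have "N 0 < N z"
  proof (rule DERIV_pos_imp_increasing_open[OF assms(1)])
    fix y assume y: "0 < y" "y < z"
    have "(N has_real_derivative bessel0 y * (bessel1 y - bessel0 y) / y) (at y)"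
      unfolding N_def using y
      by (auto intro!: derivative_eq_intros DERIV_bessel0 DERIV_bessel1 simp: field_simps power2_eq_square)
    moreover have "0 < bessel0 y * (bessel1 y - bessel0 y) / y"
      using y assms False bessel0_less_bessel1[of y] bessel0_antimono[of y z] by (intro divide_pos_pos mult_pos_pos) auto
    ultimately show "\<exists>d. (N has_real_derivative d) (at y) \<and> 0 < d" by blast
  qed (auto simp: N_def intro!: continuous_intros)
  then show ?thesis by (simp add: N_def)
qed

lemma bessel_quotient_antimono:
  assumes "0 < x" "x < y" "y < bessel_zero"
  shows "bessel0 y * bessel1 x < bessel0 x * bessel1 y"
proof -
  have "bessel0 y / bessel1 y < bessel0 x / bessel1 x"
  proof (rule DERIV_neg_imp_decreasing_open[OF \<open>x < y\<close>])
    fix t assume t: "x < t" "t < y"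
    have p: "0 < bessel1 t" "0 < t" using bessel_zero(4)[of t] t assms by auto
    have "((\<lambda>t. bessel0 t / bessel1 t) has_real_derivative
        - (t * (bessel1 t)\<^sup>2 + (bessel0 t)\<^sup>2 - bessel0 t * bessel1 t) / (t * (bessel1 t)\<^sup>2)) (at t)"
      using p by (auto intro!: derivative_eq_intros DERIV_bessel0 DERIV_bessel1 simp: divide_simps)
        (simp add: algebra_simps power2_eq_square)
    moreover have "- (t * (bessel1 t)\<^sup>2 + (bessel0 t)\<^sup>2 - bessel0 t * bessel1 t) / (t * (bessel1 t)\<^sup>2) < 0"
      using bessel_quotient_slope_sign[of t] p t assms by (intro divide_neg_pos mult_pos_pos) auto
    ultimately show "\<exists>d. ((\<lambda>t. bessel0 t / bessel1 t) has_real_derivative d) (at t) \<and> d < 0" by blast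
  next
    show "continuous_on {x..y} (\<lambda>t. bessel0 t / bessel1 t)"
      using bessel_zero(4) assms by (intro continuous_intros) (force simp: less_imp_neq[THEN not_sym])
  qed
  then show ?thesis using bessel_zero(4)[of x] bessel_zero(4)[of y] assms by (simp add: field_simps)
qed

section \<open>Joining two solutions at a peak\<close>

text \<open>Up to a positive factor, the jump of \<open>q = -w' / w\<close> at \<open>a\<close> when the two solutions for
  the eigenvalue parameter \<open>2 k\<close> of the tent with peak \<open>a\<close>, one vanishing at \<open>0\<close> and one at
  \<open>1\<close>, are joined at the peak.\<close>

definition slope_jump :: "real \<Rightarrow> real \<Rightarrow> real" where
  "slope_jump k a = bessel0 (k * a\<^sup>2) * ((1 - a) * bessel1 (k * (1 - a)\<^sup>2))
     + bessel0 (k * (1 - a)\<^sup>2) * (a * bessel1 (k * a\<^sup>2))"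

text \<open>The reason why a tent with interior peak has an eigenvalue above \<open>2 c\<close>. The derivative of the
  jump in \<open>a\<close> collapses, by the first-order system, to
  \<open>f(c a\<^sup>2) g(c (1 - a)\<^sup>2) - f(c (1 - a)\<^sup>2) g(c a\<^sup>2)\<close>, which is positive for \<open>a < 1 / 2\<close> because
  \<open>f / g\<close> decreases; the jump vanishes at \<open>a = 0\<close> since \<open>g c = 0\<close>, and it is symmetric in
  \<open>a\<close> and \<open>1 - a\<close>.\<close>

lemma slope_jump_pos:
  assumes "0 < a" "a < 1" shows "0 < slope_jump bessel_zero a"
proof -
  have main: "0 < slope_jump bessel_zero b" if b: "0 < b" "b \<le> 1/2" for b
  proof -
    have "slope_jump bessel_zero 0 < slope_jump bessel_zero b"
    proof (rule DERIV_pos_imp_increasing_open[OF b(1)])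
      fix t assume t: "0 < t" "t < b"
      have f: "((\<lambda>x. bessel0 (bessel_zero * (r x)\<^sup>2)) has_real_derivative - bessel1 (bessel_zero * (r t)\<^sup>2) * (bessel_zero * (2 * r t * r'))) (at t)"
        if "(r has_real_derivative r') (at t)" for r r'
        by (rule DERIV_chain'[OF _ DERIV_bessel0]) (auto intro!: derivative_eq_intros that)
      have g: "((\<lambda>x. bessel1 (bessel_zero * (r x)\<^sup>2)) has_real_derivative
          (bessel0 (bessel_zero * (r t)\<^sup>2) - bessel1 (bessel_zero * (r t)\<^sup>2)) / (bessel_zero * (r t)\<^sup>2) * (bessel_zero * (2 * r t * r'))) (at t)"
        if "(r has_real_derivative r') (at t)" "r t \<noteq> 0" for r r'
        by (rule DERIV_chain'[OF _ DERIV_bessel1]) (use bessel_zero(1) in \<open>auto intro!: derivative_eq_intros that\<close>)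
      have d1: "((\<lambda>x::real. x) has_real_derivative 1) (at t)"
        and d2: "((\<lambda>x. 1 - x) has_real_derivative -1) (at t)" by (auto intro!: derivative_eq_intros)
      have n: "t \<noteq> 0" "1 - t \<noteq> 0" "bessel_zero \<noteq> 0" using t b bessel_zero(1) by auto
      have "((\<lambda>x. slope_jump bessel_zero x) has_real_derivative
          bessel0 (bessel_zero * t\<^sup>2) * bessel1 (bessel_zero * (1 - t)\<^sup>2) - bessel0 (bessel_zero * (1 - t)\<^sup>2) * bessel1 (bessel_zero * t\<^sup>2)) (at t)"
        unfolding slope_jump_def
        by (rule DERIV_cong[OF DERIV_add[OF
              DERIV_mult[OF f[OF d1] DERIV_mult[OF d2 g[OF d2 n(2)]]]
              DERIV_mult[OF f[OF d2] DERIV_mult[OF d1 g[OF d1 n(1)]]]]])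
          (use n in \<open>simp add: divide_simps\<close>, algebra)
      moreover have "bessel0 (bessel_zero * (1 - t)\<^sup>2) * bessel1 (bessel_zero * t\<^sup>2) < bessel0 (bessel_zero * t\<^sup>2) * bessel1 (bessel_zero * (1 - t)\<^sup>2)"
      proof (rule bessel_quotient_antimono)
        show "bessel_zero * t\<^sup>2 < bessel_zero * (1 - t)\<^sup>2" using t b bessel_zero(1) by (simp add: power_strict_mono)
        have "(1 - t)\<^sup>2 < 1" using t b by (simp add: abs_square_less_1)
        then show "bessel_zero * (1 - t)\<^sup>2 < bessel_zero" using bessel_zero(1) by simp
      qed (use t bessel_zero(1) in simp)
      ultimately show "\<exists>d. (slope_jump bessel_zero has_real_derivative d) (at t) \<and> 0 < d"
        by (intro exI conjI) (assumption, simp)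
    qed (auto simp: slope_jump_def intro!: continuous_intros)
    then show ?thesis by (simp add: slope_jump_def bessel_zero(3))
  qed
  have "slope_jump bessel_zero (1 - a) = slope_jump bessel_zero a" by (simp add: slope_jump_def algebra_simps)
  then show ?thesis using main[of a] main[of "1 - a"] assms by (cases "a \<le> 1/2") auto
qed

text \<open>For peaks in a compact part of \<open>(0, 1)\<close>, compactness leaves room for a common parameter
  \<open>k\<close> strictly above \<open>bessel_zero\<close>. The second property keeps both half intervals left of the
  zero of \<open>g\<close>.\<close>

lemma slope_jump_pos_uniform:
  assumes "0 < \<eta>" "\<eta> < 1"
  obtains k where "bessel_zero < k" "k * (1 - \<eta>)\<^sup>2 < bessel_zero" "\<And>a. a \<in> {\<eta>..1 - \<eta>} \<Longrightarrow> 0 \<le> slope_jump k a"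
proof -
  define U where "U = {bessel_zero..bessel_zero + 1} \<times> {\<eta>..1 - \<eta>}"
  have "continuous_on U (\<lambda>p. slope_jump (fst p) (snd p))"
    unfolding slope_jump_def by (intro continuous_intros)
  moreover have "compact U" unfolding U_def by (intro compact_Times) auto
  ultimately have uc: "uniformly_continuous_on U (\<lambda>p. slope_jump (fst p) (snd p))"
    using compact_uniformly_continuous by blast
  obtain m where m: "0 < m" "\<And>a. a \<in> {\<eta>..1 - \<eta>} \<Longrightarrow> m \<le> slope_jump bessel_zero a"
  proof (cases "{\<eta>..1 - \<eta>} = {}")
    case False
    have "continuous_on {\<eta>..1 - \<eta>} (slope_jump bessel_zero)"
      unfolding slope_jump_def by (intro continuous_intros)
    then obtain a where "a \<in> {\<eta>..1 - \<eta>}" "\<And>b. b \<in> {\<eta>..1 - \<eta>} \<Longrightarrow> slope_jump bessel_zero a \<le> slope_jump bessel_zero b"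
      using continuous_attains_inf[OF compact_Icc False] by metis
    then show ?thesis using assms slope_jump_pos[of a] that[of "slope_jump bessel_zero a"] by auto
  qed (use that[of 1] in auto)
  obtain d where d: "0 < d" "\<And>p p'. p \<in> U \<Longrightarrow> p' \<in> U \<Longrightarrow> dist p' p < d \<Longrightarrow>
      dist (slope_jump (fst p') (snd p')) (slope_jump (fst p) (snd p)) < m"
    using uc m(1) unfolding uniformly_continuous_on_def by metis
  define r where "r = (1 - \<eta>)\<^sup>2"
  have r: "0 < r" "r < 1" unfolding r_def using assms by (auto simp: power_less_one_iff)
  have "bessel_zero < bessel_zero / r" using r bessel_zero(1) by (simp add: field_simps)
  then have "bessel_zero < min (bessel_zero / r) (bessel_zero + min 1 d)" using d(1) by simp
  then obtain k where k: "bessel_zero < k" "k < bessel_zero / r" "k < bessel_zero + min 1 d"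
    using dense by (metis min_less_iff_conj)
  show thesis
  proof (rule that[OF k(1)])
    show "k * (1 - \<eta>)\<^sup>2 < bessel_zero" using k(2) r by (simp add: field_simps r_def)
    fix a assume a: "a \<in> {\<eta>..1 - \<eta>}"
    have "dist (slope_jump k a) (slope_jump bessel_zero a) < m"
      using d(2)[of "(bessel_zero, a)" "(k, a)"] a k by (simp add: U_def dist_Pair_Pair dist_real_def)
    then show "0 \<le> slope_jump k a" using m(2)[OF a] by (simp add: dist_real_def)
  qed
qed

section \<open>Weighted Poincare inequalities\<close>

text \<open>Test functions \<open>w = \<integral> v\<close> of the dual problem, with \<open>V\<close> the continuous
  representative of \<open>v\<close>; the two boundary conditions say that \<open>v\<close> has mean zero.\<close>

definition vanishing_C1 :: "(real \<Rightarrow> real) \<Rightarrow> (real \<Rightarrow> real) \<Rightarrow> bool" where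
  "vanishing_C1 w V \<longleftrightarrow> (\<forall>x\<in>{0..1}. (w has_real_derivative V x) (at x within {0..1})) \<and>
     continuous_on {0..1} V \<and> w 0 = 0 \<and> w 1 = 0"

text \<open>Weighted Poincare inequality with weight \<open>1 / h\<close>, the dual form of \<open>1 / C \<le> \<sigma>\<^sub>1(h)\<close>.
  Integrability is part of it, since the value of a divergent integral would be \<open>0\<close>.\<close>

definition poincare :: "(real \<Rightarrow> real) \<Rightarrow> real \<Rightarrow> bool" where
  "poincare h C \<longleftrightarrow> (\<forall>w V. vanishing_C1 w V \<longrightarrow>
     (\<lambda>x. (w x)\<^sup>2 / h x) integrable_on {0..1} \<and>
     integral {0..1} (\<lambda>x. (w x)\<^sup>2 / h x) \<le> C * integral {0..1} (\<lambda>x. (V x)\<^sup>2))"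

lemma vanishing_C1_subinterval:
  assumes "vanishing_C1 w V" "0 \<le> b" "b \<le> 1"
  shows "\<And>x. x \<in> {0..b} \<Longrightarrow> (w has_real_derivative V x) (at x within {0..b})"
    and "continuous_on {0..b} V" and "w 0 = 0"
  using assms unfolding vanishing_C1_def
  by (auto intro: has_field_derivative_subset[of _ _ _ "{0..1}"] continuous_on_subset)

lemma vanishing_C1_square_integral_nonneg: "0 \<le> integral {0..1} (\<lambda>x. (V x)\<^sup>2)" for V :: "real \<Rightarrow> real"
  by (cases "(\<lambda>x. (V x)\<^sup>2) integrable_on {0..1}") (auto simp: integral_nonneg not_integrable_integral)

text \<open>At the end points the integrand is \<open>0\<close> whatever the weight, because \<open>w\<close> vanishes.\<close>

lemma poincare_cong:
  assumes "poincare h C" and eq: "\<And>x. 0 < x \<Longrightarrow> x < 1 \<Longrightarrow> h x = k x"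
  shows "poincare k C"
proof -
  have *: "(w x)\<^sup>2 / k x = (w x)\<^sup>2 / h x" if "vanishing_C1 w V" "x \<in> {0..1}" for w V x
    using that eq[of x] by (cases "x = 0 \<or> x = 1") (auto simp: vanishing_C1_def)
  show ?thesis
    unfolding poincare_def
  proof (intro allI impI)
    fix w V assume wV: "vanishing_C1 w V"
    have "(\<lambda>x. (w x)\<^sup>2 / k x) integrable_on {0..1} \<longleftrightarrow> (\<lambda>x. (w x)\<^sup>2 / h x) integrable_on {0..1}"
      by (rule integrable_cong) (rule *[OF wV])
    moreover have "integral {0..1} (\<lambda>x. (w x)\<^sup>2 / k x) = integral {0..1} (\<lambda>x. (w x)\<^sup>2 / h x)"
      by (rule integral_cong) (rule *[OF wV])
    ultimately show "(\<lambda>x. (w x)\<^sup>2 / k x) integrable_on {0..1} \<and>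
        integral {0..1} (\<lambda>x. (w x)\<^sup>2 / k x) \<le> C * integral {0..1} (\<lambda>x. (V x)\<^sup>2)"
      using assms(1) wV unfolding poincare_def by auto
  qed
qed

lemma has_integral_reflect_unit:
  fixes F :: "real \<Rightarrow> real"
  assumes "(F has_integral I) {a..b}"
  shows "((\<lambda>x. F (1 - x)) has_integral I) {1 - b..1 - a}"
proof -
  have "(\<lambda>x::real. (1 / - 1) *\<^sub>R x + - ((1 / - 1) *\<^sub>R 1)) = (\<lambda>x. 1 - x)" by (rule ext) simp
  moreover have "(\<lambda>x::real. F (- 1 *\<^sub>R x + 1)) = (\<lambda>x. F (1 - x))" by (rule ext) simp
  ultimately show ?thesis
    using has_integral_affinity[of F I a b "-1" 1] assms by (simp only: box_real) simp
qed

lemma vanishing_C1_reflect: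
  assumes "vanishing_C1 w V" shows "vanishing_C1 (\<lambda>x. w (1 - x)) (\<lambda>x. - V (1 - x))"
proof -
  have "((\<lambda>x. w (1 - x)) has_real_derivative V (1 - x) * (-1)) (at x within {0..1})" if "x \<in> {0..1}" for x
  proof -
    have im: "(\<lambda>x. 1 - x) ` {0..1} = {0..1::real}" by simp
    have "1 - x \<in> {0..1}" using that by simp
    then have a: "(w has_real_derivative V (1 - x)) (at (1 - x) within (\<lambda>x. 1 - x) ` {0..1})"
      using assms unfolding im vanishing_C1_def by blast
    have b: "((\<lambda>x::real. 1 - x) has_real_derivative -1) (at x within {0..1})"
      by (auto intro!: derivative_eq_intros)
    from DERIV_image_chain[OF a b]
    show "((\<lambda>x. w (1 - x)) has_real_derivative V (1 - x) * (-1)) (at x within {0..1})"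
      by (simp add: o_def)
  qed
  moreover have "continuous_on {0..1} (\<lambda>x. - V (1 - x))"
  proof (rule continuous_on_minus, rule continuous_on_compose2[where g=V and f="\<lambda>x. 1 - x" and t="{0..1}"])
    show "continuous_on {0..1} V" using assms by (simp add: vanishing_C1_def)
  qed (auto intro!: continuous_intros)
  ultimately show ?thesis using assms by (simp add: vanishing_C1_def)
qed

lemma poincare_reflect:
  assumes "poincare h C" shows "poincare (\<lambda>x. h (1 - x)) C"
  unfolding poincare_def
proof (intro allI impI)
  fix w V assume wV: "vanishing_C1 w V"
  let ?w = "\<lambda>x. w (1 - x)" and ?V = "\<lambda>x. - V (1 - x)"
  have *: "(\<lambda>x. (?w x)\<^sup>2 / h x) integrable_on {0..1}"
    "integral {0..1} (\<lambda>x. (?w x)\<^sup>2 / h x) \<le> C * integral {0..1} (\<lambda>x. (?V x)\<^sup>2)"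
    using assms vanishing_C1_reflect[OF wV] unfolding poincare_def by blast+
  have 1: "((\<lambda>x. (w x)\<^sup>2 / h (1 - x)) has_integral integral {0..1} (\<lambda>x. (?w x)\<^sup>2 / h x)) {0..1}"
    using has_integral_reflect_unit[OF integrable_integral[OF *(1)]] by simp
  have "(\<lambda>x. (V x)\<^sup>2) integrable_on {0..1}"
    using wV unfolding vanishing_C1_def by (intro integrable_continuous_real continuous_intros) auto
  from has_integral_reflect_unit[OF integrable_integral[OF this]]
  have "integral {0..1} (\<lambda>x. (?V x)\<^sup>2) = integral {0..1} (\<lambda>x. (V x)\<^sup>2)"
    by (simp add: integral_unique)
  then show "(\<lambda>x. (w x)\<^sup>2 / h (1 - x)) integrable_on {0..1} \<and>
      integral {0..1} (\<lambda>x. (w x)\<^sup>2 / h (1 - x)) \<le> C * integral {0..1} (\<lambda>x. (V x)\<^sup>2)"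
    using 1 *(2) by (auto simp: integral_unique)
qed

lemma weight_scaling_bound: "0 < k \<Longrightarrow> k * J \<le> N \<Longrightarrow> 1 / 2 * J \<le> 1 / (2 * k) * N" for k :: real
  by (simp add: field_simps)

text \<open>The half-interval inequality on all of \<open>(0, 1)\<close> has no boundary term as \<open>w 1 = 0\<close>, so it
  may be taken to the limit \<open>\<beta> \<rightarrow> bessel_zero\<close>.\<close>

lemma poincare_T1: "poincare (\<lambda>x. 2 * x) (1 / (2 * bessel_zero))"
  unfolding poincare_def
proof (intro allI impI conjI)
  fix w V assume wV: "vanishing_C1 w V"
  note w = vanishing_C1_subinterval[OF wV zero_le_one order_refl]
  have c: "continuous_on {0..1} (\<lambda>x. (w x)\<^sup>2 / x)"
    by (rule continuous_on_sq_div[OF _ w]) auto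
  then have "(\<lambda>x. (w x)\<^sup>2 / x) integrable_on {0..1}" by (rule integrable_continuous_real)
  then have h: "((\<lambda>x. 1 / 2 * ((w x)\<^sup>2 / x)) has_integral 1 / 2 * integral {0..1} (\<lambda>x. (w x)\<^sup>2 / x)) {0..1}"
    by (intro has_integral_mult_right integrable_integral)
  have eq: "(w x)\<^sup>2 / (2 * x) = 1 / 2 * ((w x)\<^sup>2 / x)" for x by simp
  show "(\<lambda>x. (w x)\<^sup>2 / (2 * x)) integrable_on {0..1}" unfolding eq using h by blast
  have "bessel_zero * integral {0..1} (\<lambda>x. (w x)\<^sup>2 / x) \<le> integral {0..1} (\<lambda>x. (V x)\<^sup>2)"
  proof (rule tendsto_upperbound)
    show "((\<lambda>\<beta>. \<beta> * integral {0..1} (\<lambda>x. (w x)\<^sup>2 / x)) \<longlongrightarrow>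
        bessel_zero * integral {0..1} (\<lambda>x. (w x)\<^sup>2 / x)) (at_left bessel_zero)"
      by (intro tendsto_intros)
    show "\<forall>\<^sub>F \<beta> in at_left bessel_zero. \<beta> * integral {0..1} (\<lambda>x. (w x)\<^sup>2 / x) \<le> integral {0..1} (\<lambda>x. (V x)\<^sup>2)"
      using eventually_at_left_real[OF bessel_zero(1)]
    proof eventually_elim
      fix \<beta> assume "\<beta> \<in> {0<..<bessel_zero}"
      then show "\<beta> * integral {0..1} (\<lambda>x. (w x)\<^sup>2 / x) \<le> integral {0..1} (\<lambda>x. (V x)\<^sup>2)"
        using half_interval_inequality[of 1 \<beta> w V, OF _ _ w] bessel_zero(4) wV by (simp add: vanishing_C1_def)
    qed
  qed simp
  then show "integral {0..1} (\<lambda>x. (w x)\<^sup>2 / (2 * x)) \<le> 1 / (2 * bessel_zero) * integral {0..1} (\<lambda>x. (V x)\<^sup>2)"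
    unfolding eq integral_unique[OF h] by (rule weight_scaling_bound[OF bessel_zero(1)])
qed

lemma poincare_T0: "poincare (\<lambda>x. 2 * (1 - x)) (1 / (2 * bessel_zero))"
  using poincare_reflect[OF poincare_T1] .

text \<open>Jacobi's method with \<open>q = 3 tan (3 (x - 1 / 2))\<close>, which solves \<open>q' = 9 + q\<^sup>2\<close> and is regular
  on \<open>[0, 1]\<close> because \<open>3 / 2 < \<pi> / 2\<close>. The constant is not the best one, \<open>1 / \<pi>\<^sup>2\<close>, but it
  beats \<open>1 / (2 bessel_zero) \<ge> 1 / 8\<close>.\<close>

lemma poincare_one: "poincare (\<lambda>x. 1) (1 / 9)"
  unfolding poincare_def
proof (intro allI impI conjI)
  fix w V assume wV: "vanishing_C1 w V"
  have cw: "continuous_on {0..1} w" using wV DERIV_continuous_on unfolding vanishing_C1_def by blast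
  show i: "(\<lambda>x. (w x)\<^sup>2 / 1) integrable_on {0..1}"
    using cw by (intro integrable_continuous_real continuous_intros) auto
  define q where "q = (\<lambda>x::real. 3 * tan (3 * (x - 1 / 2)))"
  have cos: "cos (3 * (x - 1 / 2)) \<noteq> 0" if "x \<in> {0..1}" for x :: real
    using cos_gt_zero_pi[of "3 * (x - 1 / 2)"] that pi_gt3 by auto
  define S' where "S' = (\<lambda>x::real. 2 * q x * w x * V x + (9 + (q x)\<^sup>2) * (w x)\<^sup>2)"
  have "(S' has_integral (q 1 * (w 1)\<^sup>2 - q 0 * (w 0)\<^sup>2)) {0..1}"
  proof (rule fundamental_theorem_of_calculus)
    fix x :: real assume x: "x \<in> {0..1}"
    have wx: "(w has_real_derivative V x) (at x within {0..1})"
      using wV x by (auto simp: vanishing_C1_def)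
    have qx: "(q has_real_derivative 9 + (q x)\<^sup>2) (at x within {0..1})"
    proof -
      have "(q has_real_derivative 9 * inverse ((cos (3 * (x - 1 / 2)))\<^sup>2)) (at x within {0..1})"
        unfolding q_def using cos[OF x] by (auto intro!: derivative_eq_intros)
      also have "9 * inverse ((cos (3 * (x - 1 / 2)))\<^sup>2) = 9 + (q x)\<^sup>2"
        using tan_sec[OF cos[OF x]] by (simp add: q_def power_mult_distrib power_inverse)
      finally show ?thesis .
    qed
    have "((\<lambda>x. q x * (w x)\<^sup>2) has_real_derivative S' x) (at x within {0..1})"
      unfolding S'_def by (rule derivative_eq_intros wx qx refl)+ (simp add: algebra_simps)
    then show "((\<lambda>x. q x * (w x)\<^sup>2) has_vector_derivative S' x) (at x within {0..1})"
      by (simp add: has_real_derivative_iff_has_vector_derivative)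
  qed simp
  then have S: "(S' has_integral 0) {0..1}" using wV by (simp add: vanishing_C1_def)
  have iV: "(\<lambda>x. (V x)\<^sup>2) integrable_on {0..1}"
    using wV unfolding vanishing_C1_def by (intro integrable_continuous_real continuous_intros) auto
  have "((\<lambda>x. (V x)\<^sup>2 + S' x - 9 * ((w x)\<^sup>2 / 1)) has_integral
     (integral {0..1} (\<lambda>x. (V x)\<^sup>2) + 0 - 9 * integral {0..1} (\<lambda>x. (w x)\<^sup>2 / 1))) {0..1}"
    by (intro has_integral_diff has_integral_add has_integral_mult_right S integrable_integral i iV)
  moreover have "0 \<le> (V x)\<^sup>2 + S' x - 9 * ((w x)\<^sup>2 / 1)" for x
  proof -
    have "(V x)\<^sup>2 + S' x - 9 * ((w x)\<^sup>2 / 1) = (V x + q x * w x)\<^sup>2"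
      unfolding S'_def by (simp add: power2_eq_square algebra_simps)
    then show ?thesis by simp
  qed
  ultimately have "0 \<le> integral {0..1} (\<lambda>x. (V x)\<^sup>2) + 0 - 9 * integral {0..1} (\<lambda>x. (w x)\<^sup>2 / 1)"
    by (rule has_integral_nonneg)
  then show "integral {0..1} (\<lambda>x. (w x)\<^sup>2 / 1) \<le> 1 / 9 * integral {0..1} (\<lambda>x. (V x)\<^sup>2)" by simp
qed

section \<open>Tents and their mixtures\<close>

text \<open>The extreme points of the set of normalised profiles. The value at \<open>x = a\<close> is given by the
  left branch, so for \<open>a = 0\<close> the formula is that of \<open>T0\<close> only for \<open>x > 0\<close>.\<close>

definition tent :: "real \<Rightarrow> real \<Rightarrow> real" where
  "tent a x = (if x \<le> a then 2 * x / a else 2 * (1 - x) / (1 - a))"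

lemma tent_pos: "0 \<le> a \<Longrightarrow> a \<le> 1 \<Longrightarrow> 0 < x \<Longrightarrow> x < 1 \<Longrightarrow> 0 < tent a x"
  by (auto simp: tent_def)

lemma poincare_tent_0: "poincare (tent 0) (1 / (2 * bessel_zero))"
  by (rule poincare_cong[OF poincare_T0]) (simp add: tent_def)

lemma poincare_tent_1: "poincare (tent 1) (1 / (2 * bessel_zero))"
  by (rule poincare_cong[OF poincare_T1]) (simp add: tent_def)

text \<open>The half-interval inequality from either end point up to the peak, where \<open>tent a\<close> is
  \<open>2 x / a\<close> and \<open>2 (1 - x) / (1 - a)\<close>. The two boundary terms at the peak add up to a
  nonnegative multiple of \<open>slope_jump k a\<close>.\<close>

lemma poincare_tent:
  assumes a: "0 < a" "a < 1" and k: "0 < k" "k * a\<^sup>2 < bessel_zero" "k * (1 - a)\<^sup>2 < bessel_zero" and slope_jump: "0 \<le> slope_jump k a"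
  shows "poincare (tent a) (1 / (2 * k))"
  unfolding poincare_def
proof (intro allI impI)
  have half: "(\<lambda>x. (w x)\<^sup>2 / x) integrable_on {0..b}"
      "k * b * integral {0..b} (\<lambda>x. (w x)\<^sup>2 / x) + bessel0 (k * b\<^sup>2) / (b * bessel1 (k * b\<^sup>2)) * (w b)\<^sup>2
         \<le> integral {0..b} (\<lambda>x. (V x)\<^sup>2)"
    if "vanishing_C1 w V" "0 < b" "b < 1" "k * b\<^sup>2 < bessel_zero" for w V b
  proof -
    have "0 \<le> b" "b \<le> 1" using that by auto
    note w = vanishing_C1_subinterval[OF that(1) this]
    show "(\<lambda>x. (w x)\<^sup>2 / x) integrable_on {0..b}"
      using continuous_on_sq_div[OF \<open>0 \<le> b\<close> w] by (rule integrable_continuous_real)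
    show "k * b * integral {0..b} (\<lambda>x. (w x)\<^sup>2 / x) + bessel0 (k * b\<^sup>2) / (b * bessel1 (k * b\<^sup>2)) * (w b)\<^sup>2
         \<le> integral {0..b} (\<lambda>x. (V x)\<^sup>2)"
      using half_interval_inequality[of b "k * b" w V, OF that(2) _ w] that bessel_zero(4) k(1)
      by (simp add: power2_eq_square mult.assoc)
  qed
  fix w V assume wV: "vanishing_C1 w V"
  let ?L = "integral {0..a} (\<lambda>x. (w x)\<^sup>2 / x)" and ?R = "integral {0..1 - a} (\<lambda>x. (w (1 - x))\<^sup>2 / x)"
  let ?P = "\<lambda>b. bessel0 (k * b\<^sup>2) / (b * bessel1 (k * b\<^sup>2))"
  note L = half[OF wV a k(2)]
  have a': "0 < 1 - a" "1 - a < 1" using a by auto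
  note R = half[OF vanishing_C1_reflect[OF wV] a' k(3)]
  have hl: "((\<lambda>x. (w x)\<^sup>2 / tent a x) has_integral a / 2 * ?L) {0..a}"
    by (rule has_integral_eq[OF _ has_integral_mult_right[OF integrable_integral[OF L(1)], of "a / 2"]])
      (simp add: tent_def)
  have "((\<lambda>x. (w x)\<^sup>2 / (1 - x)) has_integral ?R) {a..1}"
    using has_integral_reflect_unit[OF integrable_integral[OF R(1)]] by simp
  from has_integral_mult_right[OF this, of "(1 - a) / 2"]
  have hr: "((\<lambda>x. (w x)\<^sup>2 / tent a x) has_integral (1 - a) / 2 * ?R) {a..1}"
  proof (rule has_integral_eq[rotated])
    fix x assume "x \<in> {a..1}"
    then show "(1 - a) / 2 * ((w x)\<^sup>2 / (1 - x)) = (w x)\<^sup>2 / tent a x"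
      using a by (cases "x = a") (auto simp: tent_def field_simps)
  qed
  have h: "((\<lambda>x. (w x)\<^sup>2 / tent a x) has_integral a / 2 * ?L + (1 - a) / 2 * ?R) {0..1}"
    using has_integral_combine[OF _ _ hl hr] a by simp
  have iV: "(\<lambda>x. (V x)\<^sup>2) integrable_on {0..1}"
    using wV unfolding vanishing_C1_def by (intro integrable_continuous_real continuous_intros) auto
  have "integral {0..1 - a} (\<lambda>x. (- V (1 - x))\<^sup>2) = integral {a..1} (\<lambda>x. (V x)\<^sup>2)"
    using has_integral_reflect_unit[OF integrable_integral[OF integrable_on_subinterval[OF iV, of a 1]]] a
    by (simp add: integral_unique)
  moreover have "integral {0..a} (\<lambda>x. (V x)\<^sup>2) + integral {a..1} (\<lambda>x. (V x)\<^sup>2) = integral {0..1} (\<lambda>x. (V x)\<^sup>2)"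
    using Henstock_Kurzweil_Integration.integral_combine[OF _ _ iV, of a] a by simp
  moreover have "0 \<le> ?P a * (w a)\<^sup>2 + ?P (1 - a) * (w a)\<^sup>2"
  proof -
    have b: "0 < bessel1 (k * a\<^sup>2)" "0 < bessel1 (k * (1 - a)\<^sup>2)" using bessel_zero(4) k by auto
    have "F / (u * B) + F' / (v * B') = (F * (v * B') + F' * (u * B)) / (u * v * B * B')"
      if "0 < u" "0 < v" "0 < B" "0 < B'" for F F' u v B B' :: real
      using that by (simp add: field_simps)
    from this[OF a(1) a'(1) b] have "?P a + ?P (1 - a) = slope_jump k a / (a * (1 - a) * bessel1 (k * a\<^sup>2) * bessel1 (k * (1 - a)\<^sup>2))"
      unfolding slope_jump_def by simp
    then have "0 \<le> ?P a + ?P (1 - a)" using slope_jump a b by simp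
    from mult_nonneg_nonneg[OF this zero_le_power2[of "w a"]] show ?thesis by (simp only: distrib_right)
  qed
  ultimately have "k * a * ?L + k * (1 - a) * ?R \<le> integral {0..1} (\<lambda>x. (V x)\<^sup>2)"
    using L(2) R(2) by simp
  then have "k * (a * ?L + (1 - a) * ?R) \<le> integral {0..1} (\<lambda>x. (V x)\<^sup>2)"
    by (simp only: distrib_left mult.assoc)
  from weight_scaling_bound[OF k(1) this]
  have "a / 2 * ?L + (1 - a) / 2 * ?R \<le> 1 / (2 * k) * integral {0..1} (\<lambda>x. (V x)\<^sup>2)"
    by (simp only: distrib_left times_divide_eq_left mult_1 mult.assoc[symmetric])
  then show "(\<lambda>x. (w x)\<^sup>2 / tent a x) integrable_on {0..1} \<and>
      integral {0..1} (\<lambda>x. (w x)\<^sup>2 / tent a x) \<le> 1 / (2 * k) * integral {0..1} (\<lambda>x. (V x)\<^sup>2)"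
    using h by (auto simp: integral_unique)
qed

text \<open>Convexity of \<open>h \<mapsto> 1 / h\<close>: for weights of total mass \<open>m\<close> the Cauchy-Schwarz inequality
  gives \<open>m\<^sup>2 \<le> (\<Sum> c \<tau>) (\<Sum> c / \<tau>)\<close>.\<close>

lemma poincare_mixture:
  fixes c C :: "'i \<Rightarrow> real"
  assumes I: "finite I" and c: "\<And>i. i \<in> I \<Longrightarrow> 0 \<le> c i" and m: "0 < (\<Sum>i\<in>I. c i)"
    and \<tau>: "\<And>i x. i \<in> I \<Longrightarrow> 0 < x \<Longrightarrow> x < 1 \<Longrightarrow> 0 < \<tau> i x"
    and P: "\<And>i. i \<in> I \<Longrightarrow> poincare (\<tau> i) (C i)"
    and h: "continuous_on {0<..<1} h"
    and le: "\<And>x. 0 < x \<Longrightarrow> x < 1 \<Longrightarrow> (\<Sum>i\<in>I. c i * \<tau> i x) \<le> h x"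
  shows "poincare h ((\<Sum>i\<in>I. c i * C i) / (\<Sum>i\<in>I. c i)\<^sup>2)"
  unfolding poincare_def
proof (intro allI impI)
  fix w V assume wV: "vanishing_C1 w V"
  let ?m = "\<Sum>i\<in>I. c i"
  let ?N = "integral {0..1} (\<lambda>x. (V x)\<^sup>2)"
  define G where "G x = (\<Sum>i\<in>I. c i * ((w x)\<^sup>2 / \<tau> i x)) / ?m\<^sup>2" for x
  have sum_pos: "0 < (\<Sum>i\<in>I. c i * \<tau> i x)" if "0 < x" "x < 1" for x
  proof -
    obtain j where "j \<in> I" "0 < c j" using m c by (metis leD linorder_not_le sum_nonpos)
    then show ?thesis
      using that \<tau> c
      by (intro sum_pos2[OF I, of j] mult_pos_pos mult_nonneg_nonneg) (auto intro: less_imp_le)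
  qed
  have bound: "(w x)\<^sup>2 / h x \<le> G x" if x: "x \<in> {0<..<1}" for x
  proof -
    let ?s = "\<Sum>i\<in>I. c i * \<tau> i x" and ?r = "\<Sum>i\<in>I. c i / \<tau> i x"
    \<comment> \<open>Cauchy-Schwarz for \<open>\<surd>(c \<tau>)\<close> and \<open>\<surd>(c / \<tau>)\<close>, whose product is \<open>c\<close>.\<close>
    have "?m = (\<Sum>i\<in>I. sqrt (c i * \<tau> i x) * sqrt (c i / \<tau> i x))"
    proof (rule sum.cong[OF refl])
      fix i assume i: "i \<in> I"
      have "sqrt (c i * \<tau> i x) * sqrt (c i / \<tau> i x) = sqrt ((c i)\<^sup>2)"
        using \<tau>[OF i, of x] x by (simp add: real_sqrt_mult[symmetric] power2_eq_square)
      then show "c i = sqrt (c i * \<tau> i x) * sqrt (c i / \<tau> i x)" using c[OF i] by simp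
    qed
    then have "?m\<^sup>2 \<le> (\<Sum>i\<in>I. (sqrt (c i * \<tau> i x))\<^sup>2) * (\<Sum>i\<in>I. (sqrt (c i / \<tau> i x))\<^sup>2)"
      using Cauchy_Schwarz_ineq_sum by metis
    also have "\<dots> = ?s * ?r"
      using c \<tau>[of _ x] x by (intro arg_cong2[of _ _ _ _ "(*)"] sum.cong refl) (auto simp: less_imp_le)
    finally have "?m\<^sup>2 \<le> ?s * ?r" .
    then have "1 / ?s \<le> ?r / ?m\<^sup>2" using sum_pos[of x] x m by (simp add: field_simps)
    moreover have "1 / h x \<le> 1 / ?s" using sum_pos[of x] le[of x] x by (intro divide_left_mono) auto
    ultimately have "(w x)\<^sup>2 * (1 / h x) \<le> (w x)\<^sup>2 * (?r / ?m\<^sup>2)" by (intro mult_left_mono) auto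
    then show ?thesis by (simp add: G_def sum_distrib_left mult.commute)
  qed
  have "((\<lambda>x. G x) has_integral
      (\<Sum>i\<in>I. c i * integral {0..1} (\<lambda>x. (w x)\<^sup>2 / \<tau> i x)) / ?m\<^sup>2) {0..1}"
    unfolding G_def using P wV unfolding poincare_def
    by (intro has_integral_divide has_integral_sum I has_integral_mult_right integrable_integral) auto
  then have G: "G integrable_on {0..1}"
    "integral {0..1} G = (\<Sum>i\<in>I. c i * integral {0..1} (\<lambda>x. (w x)\<^sup>2 / \<tau> i x)) / ?m\<^sup>2"
    by (auto simp: integral_unique)
  have cw: "continuous_on {0<..<1} w"
    using wV DERIV_continuous_on unfolding vanishing_C1_def
    by (metis continuous_on_subset greaterThanLessThan_subseteq_atLeastAtMost_iff order_refl)
  have hpos: "0 < h x" if "x \<in> {0<..<1}" for x using sum_pos[of x] le[of x] that by auto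
  have "continuous_on {0<..<1} (\<lambda>x. (w x)\<^sup>2 / h x)"
    using hpos by (intro continuous_intros cw h) (auto simp: less_imp_neq[THEN not_sym])
  then have "(\<lambda>x. (w x)\<^sup>2 / h x) \<in> borel_measurable (lebesgue_on {0<..<1})"
    by (rule continuous_imp_measurable_on_sets_lebesgue) simp
  then have i: "(\<lambda>x. (w x)\<^sup>2 / h x) integrable_on {0<..<1}"
    by (rule measurable_bounded_by_integrable_imp_integrable_real[where g=G])
      (use G(1) bound hpos in \<open>auto simp: integrable_on_open_interval_real less_imp_le abs_of_pos\<close>)
  have "integral {0..1} (\<lambda>x. (w x)\<^sup>2 / h x) = integral {0<..<1} (\<lambda>x. (w x)\<^sup>2 / h x)"
    by (simp add: integral_open_interval_real)
  also have "\<dots> \<le> integral {0<..<1} G"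
    using i G(1) bound by (intro integral_le) (auto simp: integrable_on_open_interval_real)
  also have "\<dots> = (\<Sum>i\<in>I. c i * integral {0..1} (\<lambda>x. (w x)\<^sup>2 / \<tau> i x)) / ?m\<^sup>2"
    by (simp only: integral_open_interval_real[symmetric] G(2))
  also have "\<dots> \<le> (\<Sum>i\<in>I. c i * (C i * ?N)) / ?m\<^sup>2"
    using P wV c unfolding poincare_def by (intro divide_right_mono sum_mono mult_left_mono) auto
  also have "\<dots> = (\<Sum>i\<in>I. c i * C i) / ?m\<^sup>2 * ?N"
    by (simp add: sum_distrib_right mult.assoc)
  finally show "(\<lambda>x. (w x)\<^sup>2 / h x) integrable_on {0..1} \<and>
      integral {0..1} (\<lambda>x. (w x)\<^sup>2 / h x) \<le> (\<Sum>i\<in>I. c i * C i) / ?m\<^sup>2 * ?N"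
    using i by (simp add: integrable_on_open_interval_real)
qed

lemma poincare_mono:
  assumes "poincare h C" "C \<le> D" shows "poincare h D"
  unfolding poincare_def
proof (intro allI impI conjI)
  fix w V assume wV: "vanishing_C1 w V"
  then show "(\<lambda>x. (w x)\<^sup>2 / h x) integrable_on {0..1}"
    using assms(1) unfolding poincare_def by blast
  have "integral {0..1} (\<lambda>x. (w x)\<^sup>2 / h x) \<le> C * integral {0..1} (\<lambda>x. (V x)\<^sup>2)"
    using assms(1) wV unfolding poincare_def by blast
  also have "\<dots> \<le> D * integral {0..1} (\<lambda>x. (V x)\<^sup>2)"
    using assms(2) vanishing_C1_square_integral_nonneg by (rule mult_right_mono)
  finally show "integral {0..1} (\<lambda>x. (w x)\<^sup>2 / h x) \<le> D * integral {0..1} (\<lambda>x. (V x)\<^sup>2)" .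
qed

section \<open>Concave profiles as mixtures of tents\<close>

lemma tent_has_integral:
  assumes "0 \<le> a" "a \<le> 1" shows "(tent a has_integral 1) {0..1}"
proof -
  have "((\<lambda>x. 2 * x * r) has_integral (a\<^sup>2 * r - 0\<^sup>2 * r)) {0..a}" for r
    by (rule fundamental_theorem_of_calculus)
      (use assms in \<open>auto intro!: derivative_eq_intros simp flip: has_real_derivative_iff_has_vector_derivative\<close>)
  from this[of "1 / a"] have "((\<lambda>x. 2 * x / a) has_integral a) {0..a}"
    by (simp add: power2_eq_square)
  then have 1: "(tent a has_integral a) {0..a}"
    by (rule has_integral_eq[rotated]) (simp add: tent_def)
  have "((\<lambda>x. 2 * (1 - x) * r) has_integral (- ((1 - 1)\<^sup>2 * r) - - ((1 - a)\<^sup>2 * r))) {a..1}" for r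
    by (rule fundamental_theorem_of_calculus)
      (use assms in \<open>auto intro!: derivative_eq_intros simp flip: has_real_derivative_iff_has_vector_derivative simp: algebra_simps\<close>)
  from this[of "1 / (1 - a)"]
  have "((\<lambda>x. 2 * (1 - x) / (1 - a)) has_integral (1 - a)) {a..1}"
    by (cases "a = 1") (simp_all add: power2_eq_square)
  then have 2: "(tent a has_integral (1 - a)) {a..1}"
    by (rule has_integral_spike_finite[of "{a}", rotated 2]) (auto simp: tent_def)
  show ?thesis using has_integral_combine[OF assms 1 2] by simp
qed

lemma tent_half_le:
  assumes "0 \<le> a" "a \<le> 1" shows "tent a (1 / 2) \<le> 2"
  using assms by (auto simp: tent_def field_simps)

text \<open>The excess of the midpoint value over the mean \<open>1\<close> is small for peaks near the end points;
  it therefore measures how much mass a mixture puts on interior peaks.\<close>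

lemma tent_half_le_near_ends:
  assumes "0 \<le> a" "a \<le> 1" "0 < \<eta>" "\<eta> \<le> 1 / 4" "a < \<eta> \<or> 1 - \<eta> < a"
  shows "tent a (1 / 2) \<le> 1 + 2 * \<eta>"
proof -
  have *: "1 / (1 - b) \<le> 1 + 2 * \<eta>" if "0 \<le> b" "b < \<eta>" for b
  proof -
    have "0 \<le> b * (1 - 2 * b)" using that assms by (intro mult_nonneg_nonneg) auto
    then have "1 \<le> (1 + 2 * b) * (1 - b)" by (simp add: algebra_simps)
    then have "1 / (1 - b) \<le> 1 + 2 * b" using that assms by (simp add: field_simps)
    then show ?thesis using that by simp
  qed
  show ?thesis using *[of a] *[of "1 - a"] assms by (auto simp: tent_def)
qed

lemma concave_chord_le:
  fixes h :: "real \<Rightarrow> real"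
  assumes "concave_on {0..1} h" "p \<in> {0..1}" "q \<in> {0..1}" "0 \<le> t" "t \<le> 1"
  shows "h p + t * (h q - h p) \<le> h (p + t * (q - p))"
  using concave_onD[OF assms(1,4,5,2,3)] by (simp add: algebra_simps)

text \<open>A discrete Choquet representation. The piecewise linear interpolant of \<open>h\<close> at the points
  \<open>i / n\<close> lies below \<open>h\<close> by concavity and uniformly close to it for large \<open>n\<close>. It is a
  nonnegative combination of tents with peaks at the nodes: its kinks are concave, and a kink of
  size \<open>k\<close> at \<open>y\<close> contributes \<open>k y (1 - y) / 2\<close> times \<open>tent y\<close>.\<close>

lemma concave_tent_approximation:
  fixes h :: "real \<Rightarrow> real"
  assumes cont: "continuous_on {0..1} h" and conc: "concave_on {0..1} h"
    and nonneg: "\<And>x. x \<in> {0..1} \<Longrightarrow> 0 \<le> h x" and "0 < e"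
  shows "\<exists>(n :: nat) (c :: nat \<Rightarrow> real). 0 < n \<and> (\<forall>i. 0 \<le> c i) \<and>
    (\<forall>x\<in>{0<..<1}. (\<Sum>i\<in>{..n}. c i * tent (i / n) x) \<le> h x \<and>
       h x - e \<le> (\<Sum>i\<in>{..n}. c i * tent (i / n) x))"
proof -
  have "uniformly_continuous_on {0..1} h"
    using compact_uniformly_continuous[OF cont] by simp
  then obtain d where d: "0 < d" "\<And>x y. x \<in> {0..1} \<Longrightarrow> y \<in> {0..1} \<Longrightarrow> \<bar>x - y\<bar> < d \<Longrightarrow> \<bar>h x - h y\<bar> < e"
    using \<open>0 < e\<close> unfolding uniformly_continuous_on_def dist_real_def by metis
  obtain n where n: "0 < n" "1 / real n < d"
    using d(1) by (metis nat_approx_posE zero_less_Suc inverse_eq_divide)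
  define y where "y i = real i / real n" for i
  have y: "y i \<in> {0..1}" if "i \<le> n" for i using that n by (auto simp: y_def)
  have y_Suc: "y (Suc i) = y i + 1 / n" for i by (simp add: y_def add_divide_distrib)
  have y0: "y 0 = 0" and yn: "y n = 1" using n by (auto simp: y_def)
  define s where "s j = n * (h (y (Suc j)) - h (y j))" for j
  define k where "k i = s (i - 1) - s i" for i
  have k: "0 \<le> k i" if i: "0 < i" "i < n" for i
  proof -
    obtain j where j: "i = Suc j" using i by (cases i) auto
    have "h (y j) + 1 / 2 * (h (y (Suc i)) - h (y j)) \<le> h (y j + 1 / 2 * (y (Suc i) - y j))"
      by (rule concave_chord_le[OF conc]) (use y i j in auto)
    also have "y j + 1 / 2 * (y (Suc i) - y j) = y i" by (simp add: y_Suc j)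
    finally have "0 \<le> 2 * h (y i) - h (y j) - h (y (Suc i))" by (simp add: field_simps)
    then have "0 \<le> n * (2 * h (y i) - h (y j) - h (y (Suc i)))" by (intro mult_nonneg_nonneg) auto
    then show ?thesis by (simp add: k_def s_def j algebra_simps)
  qed
  \<comment> \<open>The interpolant with its kinks at the nodes from \<open>m\<close> on removed.\<close>
  define A where "A m x = h 0 + s 0 * x - (\<Sum>i\<in>{0<..<m}. k i * max 0 (x - y i))" for m x
  have A: "A (Suc m) x = h (y m) + s m * (x - y m)" if "y m \<le> x" for m x
    using that
  proof (induction m)
    case 0
    have "{0<..<Suc 0} = {}" by auto
    then show ?case by (simp add: A_def y0)
  next
    case (Suc m)
    have "{0<..<Suc (Suc m)} = insert (Suc m) {0<..<Suc m}" by auto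
    then have "A (Suc (Suc m)) x = A (Suc m) x - k (Suc m) * (x - y (Suc m))"
      using Suc.prems by (simp add: A_def)
    also have "A (Suc m) x = h (y m) + s m * (x - y m)"
    proof (rule Suc.IH)
      have "0 < 1 / real n" using n by simp
      then show "y m \<le> x" using Suc.prems unfolding y_Suc by linarith
    qed
    also have "h (y m) + s m * (x - y m) - k (Suc m) * (x - y (Suc m))
        = h (y m) + s m * (y (Suc m) - y m) + s (Suc m) * (x - y (Suc m))"
      by (simp add: k_def algebra_simps)
    also have "s m * (y (Suc m) - y m) = h (y (Suc m)) - h (y m)"
      using n by (simp add: y_Suc s_def)
    finally show ?case by simp
  qed
  obtain n' where n': "n = Suc n'" using n by (cases n) auto
  have An1: "A n 1 = h 1"
  proof -
    have "y n' \<le> 1" using y[of n'] n' by simp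
    then have "A n 1 = h (y n') + s n' * (1 - y n')" using A n' by simp
    also have "1 - y n' = 1 / n" using yn y_Suc[of n'] n' by simp
    finally show ?thesis using n yn n' by (simp add: s_def)
  qed
  \<comment> \<open>The end tents carry the boundary values, as \<open>tent 0\<close> and \<open>tent 1\<close> tend to \<open>2\<close> there.\<close>
  define c where "c i = (if i = 0 then h 0 / 2 else if i = n then h 1 / 2
      else if i < n then k i * y i * (1 - y i) / 2 else 0)" for i
  have "0 \<le> c i" for i
    using nonneg[of 0] nonneg[of 1] k[of i] y[of i] by (auto simp: c_def)
  moreover have sum: "(\<Sum>i\<in>{..n}. c i * tent (i / n) x) = A n x" if x: "x \<in> {0<..<1}" for x
  proof -
    have "{..n} = insert 0 (insert n {0<..<n})" using n by auto
    then have "(\<Sum>i\<in>{..n}. c i * tent (i / n) x)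
        = c 0 * tent (y 0) x + c n * tent (y n) x + (\<Sum>i\<in>{0<..<n}. c i * tent (y i) x)"
      using n by (simp add: y_def)
    also have "c 0 * tent (y 0) x = h 0 * (1 - x)" using x by (simp add: c_def y0 tent_def)
    also have "c n * tent (y n) x = h 1 * x" using x n by (simp add: c_def yn tent_def)
    also have "(\<Sum>i\<in>{0<..<n}. c i * tent (y i) x)
        = (\<Sum>i\<in>{0<..<n}. k i * (1 - y i) * x - k i * max 0 (x - y i))"
    proof (rule sum.cong[OF refl])
      fix i assume "i \<in> {0<..<n}"
      then have i: "0 < i" "i < n" "y i \<noteq> 0" "1 - y i \<noteq> 0" by (auto simp: y_def)
      have "k i * y i * (1 - y i) / 2 * tent (y i) x = k i * (1 - y i) * x - k i * max 0 (x - y i)"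
      proof (cases "x \<le> y i")
        case True
        then show ?thesis using i by (simp add: tent_def max_def)
      next
        case False
        have "k i * y i * u / 2 * (2 * (1 - x) / u) = k i * y i * (1 - x)" if "u \<noteq> 0" for u
          using that by simp
        from this[OF i(4)] have "k i * y i * (1 - y i) / 2 * tent (y i) x = k i * y i * (1 - x)"
          using False by (simp only: tent_def if_False)
        then show ?thesis using False by (simp add: max_def algebra_simps)
      qed
      then show "c i * tent (y i) x = k i * (1 - y i) * x - k i * max 0 (x - y i)"
        using i by (simp add: c_def)
    qed
    also have "\<dots> = (\<Sum>i\<in>{0<..<n}. k i * (1 - y i)) * x - (\<Sum>i\<in>{0<..<n}. k i * max 0 (x - y i))"
      by (simp add: sum_subtractf sum_distrib_right)
    also have "(\<Sum>i\<in>{0<..<n}. k i * (1 - y i)) = (\<Sum>i\<in>{0<..<n}. k i * max 0 (1 - y i))"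
      using y by (intro sum.cong) (auto simp: max_def)
    also have "\<dots> = h 0 + s 0 - h 1" using An1 by (simp add: A_def)
    finally show ?thesis by (simp add: A_def algebra_simps)
  qed
  moreover have "A n x \<le> h x \<and> h x - e \<le> A n x" if x: "x \<in> {0<..<1}" for x
  proof -
    define m where "m = nat \<lfloor>n * x\<rfloor>"
    have m: "real m \<le> n * x" "n * x < real m + 1" 
    proof -
      have "real m = of_int \<lfloor>n * x\<rfloor>" using x by (simp add: m_def)
      then show "real m \<le> n * x" "n * x < real m + 1" by linarith+
    qed
    have "real n * x < real n * 1" using x n by (intro mult_strict_left_mono) auto
    then have mn: "m < n" using m(1) by simp
    define t where "t = n * (x - y m)"
    have t: "0 \<le> t" "t \<le> 1" using m n by (auto simp: t_def right_diff_distrib y_def)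
    have xt: "x = y m + t * (y (Suc m) - y m)" using n by (simp add: t_def y_Suc)
    have ym: "y m \<le> x" using m n by (simp add: y_def field_simps)
    have "A n x = A (Suc m) x"
    proof -
      have "max 0 (x - y i) = 0" if "i \<in> {0<..<n} - {0<..<Suc m}" for i
      proof -
        have "real m + 1 \<le> real i" using that by auto
        then have "n * x \<le> real i" using m by linarith
        then show ?thesis using n by (simp add: y_def field_simps)
      qed
      then have "(\<Sum>i\<in>{0<..<n}. k i * max 0 (x - y i)) = (\<Sum>i\<in>{0<..<Suc m}. k i * max 0 (x - y i))"
        using mn by (intro sum.mono_neutral_right) auto
      then show ?thesis by (simp add: A_def)
    qed
    also have "\<dots> = h (y m) + t * (h (y (Suc m)) - h (y m))"
      using A[OF ym] by (simp add: s_def t_def)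
    finally have An: "A n x = h (y m) + t * (h (y (Suc m)) - h (y m))" .
    have ys: "y m \<in> {0..1}" "y (Suc m) \<in> {0..1}" using y mn by auto
    have upper: "A n x \<le> h x"
      using concave_chord_le[OF conc ys t] An xt by simp
    have "\<bar>x - y m\<bar> < d" "\<bar>x - y (Suc m)\<bar> < d"
    proof -
      have "x - y m = t / n" using n by (simp add: t_def)
      moreover have "0 \<le> t / n" "t / n \<le> 1 / n" using t n by (auto simp: divide_right_mono)
      ultimately show "\<bar>x - y m\<bar> < d" "\<bar>x - y (Suc m)\<bar> < d" using n(2) by (auto simp: y_Suc)
    qed
    then have "h x - e \<le> h (y m)" "h x - e \<le> h (y (Suc m))"
      using d(2)[of x "y m"] d(2)[of x "y (Suc m)"] ys x by auto
    then have "(1 - t) * (h x - e) + t * (h x - e) \<le> (1 - t) * h (y m) + t * h (y (Suc m))"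
      using t by (intro add_mono mult_left_mono) auto
    then show ?thesis using upper An by (simp add: algebra_simps)
  qed
  ultimately show ?thesis using n by (intro exI[of _ n] exI[of _ c]) simp
qed

text \<open>If the midpoint value exceeds the mean, then every close enough mixture of tents puts a
  fixed mass \<open>M\<close> on peaks in \<open>[\<eta>, 1 - \<eta>]\<close>. Those tents satisfy the inequality with a constant
  strictly below \<open>1 / (2 bessel_zero)\<close>, and this gain survives the approximation.\<close>

lemma poincare_concave_midpoint:
  fixes h :: "real \<Rightarrow> real"
  assumes cont: "continuous_on {0..1} h" and conc: "concave_on {0..1} h"
    and nonneg: "\<And>x. x \<in> {0..1} \<Longrightarrow> 0 \<le> h x"
    and int: "integral {0..1} h = 1" and mid: "1 < h (1 / 2)"
  shows "\<exists>C < 1 / (2 * bessel_zero). poincare h C"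
proof -
  define d where "d = h (1 / 2) - 1"
  have d: "0 < d" using mid by (simp add: d_def)
  define \<eta> where "\<eta> = min (d / 8) (1 / 4)"
  have \<eta>: "0 < \<eta>" "\<eta> \<le> d / 8" "\<eta> \<le> 1 / 4" "\<eta> < 1" using d by (auto simp: \<eta>_def)
  obtain k where k: "bessel_zero < k" "k * (1 - \<eta>)\<^sup>2 < bessel_zero" "\<And>a. a \<in> {\<eta>..1 - \<eta>} \<Longrightarrow> 0 \<le> slope_jump k a"
    using slope_jump_pos_uniform[OF \<eta>(1,4)] by blast
  define \<theta> where "\<theta> = 1 / (2 * bessel_zero) - 1 / (2 * k)"
  have \<theta>: "0 < \<theta>" using k(1) bessel_zero(1) by (simp add: \<theta>_def field_simps)
  \<comment> \<open>As \<open>e\<close> and \<open>2 \<eta>\<close> are at most \<open>d / 4\<close>, the interior mass \<open>M\<close> will be at least \<open>d / 2\<close>; the last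
    bound keeps the loss \<open>(m - m\<^sup>2) / (2 c)\<close> from normalising the mixture below the gain \<open>M \<theta>\<close>.\<close>
  define e where "e = min (min (d / 4) (1 / 2)) (bessel_zero * d * \<theta> / 2)"
  have e: "0 < e" "e \<le> d / 4" "e \<le> 1 / 2" "e \<le> bessel_zero * d * \<theta> / 2"
    using d \<theta> bessel_zero(1) by (auto simp: e_def)
  obtain n and c :: "nat \<Rightarrow> real" where n: "0 < n" and c: "\<And>i. 0 \<le> c i"
    and le: "\<And>x. x \<in> {0<..<1} \<Longrightarrow> (\<Sum>i\<in>{..n}. c i * tent (i / n) x) \<le> h x"
    and ge: "\<And>x. x \<in> {0<..<1} \<Longrightarrow> h x - e \<le> (\<Sum>i\<in>{..n}. c i * tent (i / n) x)"
    using concave_tent_approximation[OF cont conc nonneg e(1)] by blast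
  define m where "m = (\<Sum>i\<in>{..n}. c i)"
  define J where "J = {i \<in> {..n}. real i / real n \<in> {\<eta>..1 - \<eta>}}"
  define M where "M = (\<Sum>i\<in>J. c i)"
  define C where "C i = (if i \<in> J then 1 / (2 * k) else 1 / (2 * bessel_zero))" for i
  have J: "J \<subseteq> {..n}" by (auto simp: J_def)
  have unit: "0 \<le> real i / real n" "real i / real n \<le> 1" if "i \<le> n" for i using that n by auto
  have "((\<lambda>x. \<Sum>i\<in>{..n}. c i * tent (i / n) x) has_integral (\<Sum>i\<in>{..n}. c i * 1)) {0..1}"
    by (intro has_integral_sum finite_atMost has_integral_mult_right tent_has_integral unit) auto
  then have hm: "((\<lambda>x. \<Sum>i\<in>{..n}. c i * tent (i / n) x) has_integral m) {0<..<1}"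
    by (simp add: m_def has_integral_Icc_iff_Ioo)
  have hh: "(h has_integral 1) {0<..<1}"
    using integrable_integral[OF integrable_continuous_real[OF cont]] int by (simp add: has_integral_Icc_iff_Ioo)
  have he: "((\<lambda>x::real. e) has_integral e) {0<..<1}"
    using has_integral_const_real[of e 0 1] by (simp add: has_integral_Icc_iff_Ioo)
  have m: "1 - e \<le> m" "m \<le> 1"
    using has_integral_le[OF has_integral_diff[OF hh he] hm ge] has_integral_le[OF hm hh le] by auto
  have M: "d / 2 \<le> M"
  proof -
    have "h (1 / 2) - e \<le> (\<Sum>i\<in>{..n}. c i * tent (i / n) (1 / 2))" using ge by simp
    also have "\<dots> \<le> (\<Sum>i\<in>{..n}. (1 + 2 * \<eta>) * c i + (if i \<in> J then c i else 0))"
    proof (rule sum_mono)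
      fix i assume i: "i \<in> {..n}"
      have "tent (i / n) (1 / 2) \<le> 1 + 2 * \<eta> + (if i \<in> J then 1 else 0)"
      proof (cases "i \<in> J")
        case True
        then show ?thesis using tent_half_le[OF unit, of i] i \<eta>(1) by simp
      next
        case False
        then have "real i / real n < \<eta> \<or> 1 - \<eta> < real i / real n" using i by (auto simp: J_def)
        then show ?thesis using tent_half_le_near_ends[OF unit \<eta>(1,3), of i] i False by simp
      qed
      from mult_left_mono[OF this c[of i]]
      show "c i * tent (i / n) (1 / 2) \<le> (1 + 2 * \<eta>) * c i + (if i \<in> J then c i else 0)"
        by (auto simp: algebra_simps)
    qed
    also have "\<dots> = (1 + 2 * \<eta>) * m + M"
      using J by (simp add: sum.distrib sum_distrib_left m_def M_def sum.If_cases Int_absorb1)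
    finally have "1 + d - e \<le> m + 2 * (\<eta> * m) + M" by (simp add: d_def algebra_simps)
    moreover have "\<eta> * m \<le> \<eta>" using m(2) \<eta>(1) by (simp add: mult_left_le)
    ultimately show ?thesis using m e \<eta> by linarith
  qed
  have m_pos: "0 < m" using m e by simp
  have "poincare h ((\<Sum>i\<in>{..n}. c i * C i) / (\<Sum>i\<in>{..n}. c i)\<^sup>2)"
  proof (rule poincare_mixture[where \<tau>="\<lambda>i. tent (real i / real n)"])
    show "poincare (tent (real i / real n)) (C i)" if i: "i \<in> {..n}" for i
    proof (cases "i \<in> J")
      case True
      define a where "a = real i / real n"
      have a: "a \<in> {\<eta>..1 - \<eta>}" using True by (simp add: J_def a_def)
      have "k * b\<^sup>2 < bessel_zero" if "0 \<le> b" "b \<le> 1 - \<eta>" for b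
      proof -
        have "k * b\<^sup>2 \<le> k * (1 - \<eta>)\<^sup>2" using that k(1) bessel_zero(1) by (intro mult_left_mono power_mono) auto
        then show ?thesis using k(2) by simp
      qed
      then show ?thesis
        using poincare_tent[of a k] a \<eta> k(1) k(3)[OF a] bessel_zero(1) True by (simp add: C_def a_def)
    next
      case False
      define a where "a = real i / real n"
      have "0 \<le> a" "a \<le> 1" using unit i by (auto simp: a_def)
      then consider "a = 0" | "a = 1" | "0 < a" "a < 1" by force
      then have "poincare (tent a) (1 / (2 * bessel_zero))"
      proof cases
        case 3
        have "bessel_zero * b\<^sup>2 < bessel_zero" if "0 < b" "b < 1" for b
          using that bessel_zero(1) by (simp add: abs_square_less_1)
        then show ?thesis using poincare_tent[of a bessel_zero] 3 bessel_zero(1) slope_jump_pos[of a] by simp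
      qed (use poincare_tent_0 poincare_tent_1 in auto)
      then show ?thesis using False by (simp add: C_def a_def)
    qed
    show "continuous_on {0<..<1} h" by (rule continuous_on_subset[OF cont]) auto
  qed (use c m_pos unit le tent_pos in \<open>auto simp: m_def\<close>)
  moreover have "(\<Sum>i\<in>{..n}. c i * C i) / (\<Sum>i\<in>{..n}. c i)\<^sup>2 < 1 / (2 * bessel_zero)"
  proof -
    have "(\<Sum>i\<in>{..n}. c i * C i) = (\<Sum>i\<in>{..n}. c i * (1 / (2 * bessel_zero)) - (if i \<in> J then c i * \<theta> else 0))"
      by (rule sum.cong) (auto simp: C_def \<theta>_def algebra_simps)
    also have "\<dots> = m * (1 / (2 * bessel_zero)) - M * \<theta>"
      using J by (simp add: sum_subtractf sum_distrib_right m_def M_def sum.If_cases Int_absorb1 sum_divide_distrib)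
    finally have 1: "(\<Sum>i\<in>{..n}. c i * C i) = m * (1 / (2 * bessel_zero)) - M * \<theta>" .
    have "(m - m\<^sup>2) * (1 / (2 * bessel_zero)) \<le> e * (1 / (2 * bessel_zero))"
    proof (rule mult_right_mono)
      have "(1 - m) * m \<le> e * 1" using m e m_pos by (intro mult_mono) auto
      then show "m - m\<^sup>2 \<le> e" by (simp add: power2_eq_square algebra_simps)
    qed (use bessel_zero(1) in simp)
    also have "\<dots> \<le> d * \<theta> / 4" using e(4) bessel_zero(1) by (simp add: field_simps)
    also have "\<dots> < d / 2 * \<theta>" using d \<theta> by simp
    also have "\<dots> \<le> M * \<theta>" using M \<theta> by (intro mult_right_mono) auto
    finally have "(m - m\<^sup>2) * (1 / (2 * bessel_zero)) < M * \<theta>" .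
    moreover have "m * K - M * \<theta> < K * m\<^sup>2" if "(m - m\<^sup>2) * K < M * \<theta>" for K
      using that by (simp add: algebra_simps)
    ultimately have "m * (1 / (2 * bessel_zero)) - M * \<theta> < 1 / (2 * bessel_zero) * m\<^sup>2" by blast
    then show ?thesis unfolding 1 m_def[symmetric] using m_pos by (simp add: divide_less_eq del: times_divide_eq_left times_divide_eq_right)
  qed
  ultimately show ?thesis by blast
qed

text \<open>Equality in the Hermite-Hadamard inequality: \<open>2 h (1 / 2) - h x - h (1 - x)\<close> is nonnegative with
  nonpositive integral, hence zero, and then both chord inequalities, at \<open>x\<close> and at \<open>1 - x\<close>,
  must be equalities.\<close>

lemma concave_midpoint_affine:
  fixes h :: "real \<Rightarrow> real"
  assumes cont: "continuous_on {0..1} h" and conc: "concave_on {0..1} h"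
    and int: "integral {0..1} h = 1" and mid: "h (1 / 2) \<le> 1"
  shows "h 0 + h 1 = 2" and "\<And>x. x \<in> {0..1} \<Longrightarrow> h x = (1 - x) * h 0 + x * h 1"
proof -
  define D where "D x = 2 * h (1 / 2) - (h x + h (1 - x))" for x
  have hi: "(h has_integral 1) {0..1}"
    using integrable_integral[OF integrable_continuous_real[OF cont]] int by simp
  have "((\<lambda>x. h x + h (1 - x)) has_integral 1 + 1) {0..1}"
    using has_integral_add[OF hi has_integral_reflect_unit[OF hi, simplified]] .
  from has_integral_diff[OF has_integral_const_real[of "2 * h (1 / 2)" 0 1] this]
  have Dint: "(D has_integral (2 * h (1 / 2) - 2)) {0..1}" by (simp add: D_def[abs_def])
  have cD: "continuous_on {0..1} D"
  proof -
    have "continuous_on {0..1} (\<lambda>x. h (1 - x))"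
      by (rule continuous_on_compose2[where g=h and f="\<lambda>x. 1 - x" and t="{0..1}"])
        (auto intro!: continuous_intros cont)
    then show ?thesis unfolding D_def by (intro continuous_intros cont)
  qed
  have D: "0 \<le> D x" if "x \<in> {0..1}" for x
  proof -
    have "h x + 1 / 2 * (h (1 - x) - h x) \<le> h (x + 1 / 2 * (1 - x - x))"
      by (rule concave_chord_le[OF conc]) (use that in auto)
    also have "x + 1 / 2 * (1 - x - x) = 1 / 2" by (simp add: field_simps)
    finally show ?thesis by (simp add: D_def field_simps)
  qed
  have "integral {0..1} D = 0"
    using has_integral_nonneg[OF Dint D] Dint mid by (simp add: integral_unique)
  then have "\<forall>x\<in>{0..1}. D x = 0"
    using integral_eq_0_iff[of 0 1 D] cD D by simp
  moreover have "h (1 / 2) = 1" using has_integral_nonneg[OF Dint D] mid by simp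
  ultimately have sym: "h x + h (1 - x) = 2" if "x \<in> {0..1}" for x using that by (auto simp: D_def)
  show sum: "h 0 + h 1 = 2" using sym[of 0] by simp
  fix x :: real assume x: "x \<in> {0..1}"
  have "(1 - z) * h 0 + z * h 1 \<le> h z" if "z \<in> {0..1}" for z
    using concave_chord_le[OF conc, of 0 1 z] that by (simp add: algebra_simps)
  from this[OF x] this[of "1 - x"] sym[OF x] sum x show "h x = (1 - x) * h 0 + x * h 1"
    by (simp add: algebra_simps)
qed

text \<open>An affine profile other than the two extremal ones contains a positive share of the constant
  profile, for which the inequality holds with a strictly smaller constant. The slope is
  nonnegative here; reflection covers the other sign.\<close>

lemma poincare_affine:
  assumes "0 < p" "p \<le> 1"
  shows "\<exists>C < 1 / (2 * bessel_zero). poincare (\<lambda>x. p + (1 - p) * (2 * x)) C"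
proof -
  let ?c = "\<lambda>b. if b then p else 1 - p" and ?C = "\<lambda>b. if b then 1 / 9 else 1 / (2 * bessel_zero)"
  have "poincare (\<lambda>x. p + (1 - p) * (2 * x)) ((\<Sum>b\<in>UNIV. ?c b * ?C b) / (\<Sum>b\<in>UNIV. ?c b)\<^sup>2)"
  proof (rule poincare_mixture[where \<tau>="\<lambda>b. if b then (\<lambda>x. 1) else (\<lambda>x. 2 * x)"])
    show "poincare (if b then (\<lambda>x. 1) else (\<lambda>x. 2 * x)) (?C b)" for b
      using poincare_one poincare_T1 by simp
  qed (use assms in \<open>auto simp: UNIV_bool intro!: continuous_intros\<close>)
  moreover have "(\<Sum>b\<in>UNIV. ?c b * ?C b) / (\<Sum>b\<in>UNIV. ?c b)\<^sup>2 < 1 / (2 * bessel_zero)"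
  proof -
    have "1 / 9 < 1 / (2 * bessel_zero)" using bessel_zero(1,2) by (simp add: field_simps)
    then have "p * (1 / 9) < p * (1 / (2 * bessel_zero))" using assms(1) by (rule mult_strict_left_mono)
    moreover have "p * (1 / 9) + (1 - p) * K < K" if "p * (1 / 9) < p * K" for K
      using that by (simp add: algebra_simps)
    ultimately have "p * (1 / 9) + (1 - p) * (1 / (2 * bessel_zero)) < 1 / (2 * bessel_zero)" by blast
    then show ?thesis by (simp add: UNIV_bool add.commute)
  qed
  ultimately show ?thesis by blast
qed

lemma poincare_strict:
  fixes h :: "real \<Rightarrow> real"
  assumes cont: "continuous_on {0..1} h" and conc: "concave_on {0..1} h"
    and nonneg: "\<And>x. x \<in> {0..1} \<Longrightarrow> 0 \<le> h x" and int: "integral {0..1} h = 1"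
    and not0: "\<not> (\<forall>x\<in>{0..1}. h x = T0 x)" and not1: "\<not> (\<forall>x\<in>{0..1}. h x = T1 x)"
  shows "\<exists>C < 1 / (2 * bessel_zero). poincare h C"
proof (cases "1 < h (1 / 2)")
  case True
  then show ?thesis using poincare_concave_midpoint[OF cont conc nonneg int] by blast
next
  case False
  then have mid: "h (1 / 2) \<le> 1" by simp
  note aff = concave_midpoint_affine[OF cont conc int mid]
  have h0: "0 < h 0"
  proof (rule ccontr)
    assume "\<not> 0 < h 0"
    then have "h 0 = 0" using nonneg[of 0] by simp
    then have "h x = T1 x" if "x \<in> {0..1}" for x using aff(2)[OF that] aff(1) by (simp add: T1_def)
    then show False using not1 by blast
  qed
  have h1: "0 < h 1"
  proof (rule ccontr)
    assume "\<not> 0 < h 1"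
    then have "h 1 = 0" using nonneg[of 1] by simp
    then have "h x = T0 x" if "x \<in> {0..1}" for x using aff(2)[OF that] aff(1) by (simp add: T0_def)
    then show False using not0 by blast
  qed
  show ?thesis
  proof (cases "h 0 \<le> h 1")
    case True
    have "h x = h 0 + (1 - h 0) * (2 * x)" if "0 < x" "x < 1" for x
    proof -
      have eq: "h 1 = 2 - h 0" using aff(1) by simp
      show ?thesis using aff(2)[of x, unfolded eq] that by (simp add: algebra_simps)
    qed
    moreover obtain C where "C < 1 / (2 * bessel_zero)" "poincare (\<lambda>x. h 0 + (1 - h 0) * (2 * x)) C"
      using poincare_affine[of "h 0"] h0 aff(1) True by auto
    ultimately show ?thesis using poincare_cong[of _ C h] by metis
  next
    case False
    have "h x = h 1 + (1 - h 1) * (2 * (1 - x))" if "0 < x" "x < 1" for x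
    proof -
      have eq: "h 0 = 2 - h 1" using aff(1) by simp
      show ?thesis using aff(2)[of x, unfolded eq] that by (simp add: algebra_simps)
    qed
    moreover obtain C where "C < 1 / (2 * bessel_zero)" "poincare (\<lambda>x. h 1 + (1 - h 1) * (2 * x)) C"
      using poincare_affine[of "h 1"] h1 aff(1) False by auto
    ultimately show ?thesis using poincare_cong[OF poincare_reflect, of _ C h] by metis
  qed
qed

section \<open>Integrals over the unit interval\<close>

lemma finite_unit_measure: "finite_measure unit_measure"
  by (rule finite_measure_lebesgue_on) simp

lemma AE_unit_measure_all: "(\<And>x. 0 < x \<Longrightarrow> x < 1 \<Longrightarrow> P x) \<Longrightarrow> AE x in unit_measure. P x"
  by (rule AE_I2) simp

lemma integrable_unit_imp_HK:
  fixes f :: "real \<Rightarrow> real"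
  assumes "integrable unit_measure f"
  shows "f integrable_on {0..1}" and "(LINT x|unit_measure. f x) = integral {0..1} f"
proof -
  have "(f has_integral (LINT x|unit_measure. f x)) {0..1}"
    using has_integral_integral_lebesgue_on[OF assms] by (simp add: has_integral_Icc_iff_Ioo)
  then show "f integrable_on {0..1}" "(LINT x|unit_measure. f x) = integral {0..1} f"
    by (auto simp: integral_unique)
qed

lemma integrable_unit_of_bounded:
  fixes f :: "real \<Rightarrow> real"
  assumes "f \<in> borel_measurable unit_measure" "\<And>x. 0 < x \<Longrightarrow> x < 1 \<Longrightarrow> \<bar>f x\<bar> \<le> B"
  shows "integrable unit_measure f"
  by (rule finite_measure.integrable_const_bound[OF finite_unit_measure _ assms(1), of B])
    (use assms(2) in \<open>auto intro: AE_unit_measure_all\<close>)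

lemma continuous_bounded_unit:
  fixes f :: "real \<Rightarrow> real"
  assumes "continuous_on {0..1} f"
  obtains B where "0 \<le> B" "\<And>x. x \<in> {0..1} \<Longrightarrow> \<bar>f x\<bar> \<le> B"
proof -
  have "compact (f ` {0..1})" using assms by (intro compact_continuous_image) auto
  then obtain B where B: "\<And>x. x \<in> {0..1} \<Longrightarrow> \<bar>f x\<bar> \<le> B"
    using compact_imp_bounded bounded_iff by (metis image_eqI real_norm_def)
  moreover have "0 \<le> B" using B[of 0] by auto
  ultimately show thesis using that by blast
qed

lemma continuous_measurable_unit:
  fixes f :: "real \<Rightarrow> real"
  assumes "continuous_on {0..1} f" shows "f \<in> borel_measurable unit_measure"
proof (rule continuous_imp_measurable_on_sets_lebesgue)
  show "continuous_on {0<..<1} f" by (rule continuous_on_subset[OF assms]) auto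
qed simp

lemma continuous_integrable_unit:
  fixes f :: "real \<Rightarrow> real"
  assumes "continuous_on {0..1} f" shows "integrable unit_measure f"
proof -
  obtain B where "\<And>x. x \<in> {0..1} \<Longrightarrow> \<bar>f x\<bar> \<le> B" using continuous_bounded_unit[OF assms] by blast
  then show ?thesis using continuous_measurable_unit[OF assms] by (intro integrable_unit_of_bounded[of f B]) auto
qed

lemma integrable_unit_mult_continuous:
  fixes f \<psi> :: "real \<Rightarrow> real"
  assumes f: "integrable unit_measure f" and \<psi>: "continuous_on {0..1} \<psi>"
  shows "integrable unit_measure (\<lambda>x. f x * \<psi> x)"
proof -
  obtain B where B: "0 \<le> B" "\<And>x. x \<in> {0..1} \<Longrightarrow> \<bar>\<psi> x\<bar> \<le> B" using continuous_bounded_unit[OF \<psi>] by blast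
  show ?thesis
  proof (rule Bochner_Integration.integrable_bound)
    show "integrable unit_measure (\<lambda>x. B * f x)" using f by simp
    show "(\<lambda>x. f x * \<psi> x) \<in> borel_measurable unit_measure"
      using f continuous_measurable_unit[OF \<psi>] by measurable
    show "AE x in unit_measure. norm (f x * \<psi> x) \<le> norm (B * f x)"
    proof (rule AE_unit_measure_all)
      fix x :: real assume "0 < x" "x < 1"
      then show "norm (f x * \<psi> x) \<le> norm (B * f x)"
        using mult_right_mono[OF B(2)[of x], of "\<bar>f x\<bar>"] B(1) by (simp add: abs_mult mult.commute)
    qed
  qed
qed

lemma L2_integrable:
  assumes "v \<in> L2" shows "integrable unit_measure v"
proof (rule Bochner_Integration.integrable_bound)
  show "integrable unit_measure (\<lambda>x. 1 + (v x)\<^sup>2)"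
    using assms finite_measure.integrable_const[OF finite_unit_measure, of "1::real"] by (simp add: L2_def)
  show "v \<in> borel_measurable unit_measure" using assms by (simp add: L2_def)
  have "\<bar>t\<bar> \<le> 1 + t\<^sup>2" for t :: real
    using sum_squares_ge_zero[of "\<bar>t\<bar> - 1" 0] zero_le_power2[of t] by (simp add: power2_eq_square algebra_simps)
  then show "AE x in unit_measure. norm (v x) \<le> norm (1 + (v x)\<^sup>2)" by (auto intro!: AE_I2)
qed

lemma continuous_in_L2:
  assumes "continuous_on {0..1} f" shows "f \<in> L2"
  unfolding L2_def
  using continuous_measurable_unit[OF assms] continuous_integrable_unit[of "\<lambda>x. (f x)\<^sup>2"] assms
  by (auto intro!: continuous_intros)

text \<open>Both integrals as Lebesgue integrals over the same measure, so that Fubini's theorem can be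
  applied to a kernel that encodes the triangle \<open>y \<le> x\<close>.\<close>

lemma LINT_unit_cutoff:
  fixes g :: "real \<Rightarrow> real"
  assumes g: "integrable unit_measure g"
  shows "0 \<le> x \<Longrightarrow> x \<le> 1 \<Longrightarrow> (LINT y|unit_measure. (if y \<le> x then g y else 0)) = integral {0..x} g"
    and "0 \<le> x \<Longrightarrow> x \<le> 1 \<Longrightarrow> (LINT y|unit_measure. (if x \<le> y then g y else 0)) = integral {x..1} g"
    and "integrable unit_measure (\<lambda>y. if y \<le> x then g y else 0)"
proof -
  have idm: "(\<lambda>x::real. x) \<in> borel_measurable unit_measure"
    using id_borel_measurable_lebesgue_on by (simp add: id_def)
  note [measurable] = idm
  have [measurable]: "g \<in> borel_measurable unit_measure" using g by simp
  show i: "integrable unit_measure (\<lambda>y. if y \<le> x then g y else 0)"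
    by (rule Bochner_Integration.integrable_bound[OF g]) auto
  have i2: "integrable unit_measure (\<lambda>y. if x \<le> y then g y else 0)"
    by (rule Bochner_Integration.integrable_bound[OF g]) auto
  assume x: "0 \<le> x" "x \<le> 1"
  show "(LINT y|unit_measure. (if y \<le> x then g y else 0)) = integral {0..x} g"
    using integral_restrict_Int[of "{0..1}" "{..x}" g] x
    unfolding integrable_unit_imp_HK(2)[OF i] by (simp add: min_absorb1)
  show "(LINT y|unit_measure. (if x \<le> y then g y else 0)) = integral {x..1} g"
    using integral_restrict_Int[of "{0..1}" "{x..}" g] x
    unfolding integrable_unit_imp_HK(2)[OF i2] by (simp add: max_absorb1)
qed

text \<open>One factor is the primitive of a merely integrable function, so the product has no derivative
  to which the fundamental theorem applies; instead the order of integration over the triangle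
  \<open>y \<le> x\<close> is interchanged.\<close>

lemma integration_by_parts_unit:
  fixes g \<psi> \<Psi> :: "real \<Rightarrow> real"
  assumes g: "integrable unit_measure g" and \<psi>: "continuous_on {0..1} \<psi>"
    and \<Psi>: "\<And>x. x \<in> {0..1} \<Longrightarrow> (\<Psi> has_real_derivative \<psi> x) (at x within {0..1})"
    and "\<Psi> 1 = 0"
  shows "(LINT x|unit_measure. integral {0..x} g * \<psi> x) = - (LINT x|unit_measure. g x * \<Psi> x)"
proof -
  interpret finite_measure unit_measure by (rule finite_unit_measure)
  interpret pair_sigma_finite unit_measure unit_measure ..
  let ?F = "\<lambda>x y. if y \<le> x then g y * \<psi> x else 0"
  have [measurable]: "(\<lambda>x::real. x) \<in> borel_measurable unit_measure"
    using id_borel_measurable_lebesgue_on by (simp add: id_def)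
  have [measurable]: "g \<in> borel_measurable unit_measure" using g by simp
  have [measurable]: "\<psi> \<in> borel_measurable unit_measure" using \<psi> by (rule continuous_measurable_unit)
  obtain B where B: "0 \<le> B" "\<And>x. x \<in> {0..1} \<Longrightarrow> \<bar>\<psi> x\<bar> \<le> B" using continuous_bounded_unit[OF \<psi>] by blast
  have iy: "integrable unit_measure (\<lambda>y. ?F x y)" for x
  proof -
    have "integrable unit_measure (\<lambda>y. (if y \<le> x then g y else 0) * \<psi> x)"
      using LINT_unit_cutoff(3)[OF g, of x] by simp
    also have "(\<lambda>y. (if y \<le> x then g y else 0) * \<psi> x) = (\<lambda>y. ?F x y)" by auto
    finally show ?thesis .
  qed
  have meas: "(\<lambda>(x, y). ?F x y) \<in> borel_measurable (unit_measure \<Otimes>\<^sub>M unit_measure)" by measurable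
  have "integrable (unit_measure \<Otimes>\<^sub>M unit_measure) (\<lambda>(x, y). ?F x y)"
  proof (rule Fubini_integrable[OF meas])
    show "AE x in unit_measure. integrable unit_measure (\<lambda>y. case (x, y) of (x, y) \<Rightarrow> ?F x y)"
      using iy by simp
    show "integrable unit_measure (\<lambda>x. LINT y|unit_measure. norm (case (x, y) of (x, y) \<Rightarrow> ?F x y))"
    proof (rule integrable_unit_of_bounded)
      show "(\<lambda>x. LINT y|unit_measure. norm (case (x, y) of (x, y) \<Rightarrow> ?F x y)) \<in> borel_measurable unit_measure"
        by measurable
      fix x :: real assume x: "0 < x" "x < 1"
      have "(LINT y|unit_measure. norm (?F x y)) \<le> (LINT y|unit_measure. B * \<bar>g y\<bar>)"
      proof (rule integral_mono)
        show "norm (?F x y) \<le> B * \<bar>g y\<bar>" for y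
          using mult_right_mono[OF B(2)[of x], of "\<bar>g y\<bar>"] B(1) x by (simp add: abs_mult mult.commute)
      qed (use iy g in auto)
      then show "\<bar>LINT y|unit_measure. norm (case (x, y) of (x, y) \<Rightarrow> ?F x y)\<bar> \<le> (LINT y|unit_measure. B * \<bar>g y\<bar>)"
        by simp
    qed
  qed
  from Fubini_integral[OF this]
  have fub: "(LINT y|unit_measure. LINT x|unit_measure. ?F x y) = (LINT x|unit_measure. LINT y|unit_measure. ?F x y)" .
  have "(LINT x|unit_measure. integral {0..x} g * \<psi> x) = (LINT x|unit_measure. LINT y|unit_measure. ?F x y)"
  proof (rule Bochner_Integration.integral_cong[OF refl])
    fix x assume "x \<in> space unit_measure"
    then have "integral {0..x} g = (LINT y|unit_measure. (if y \<le> x then g y else 0))"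
      using LINT_unit_cutoff(1)[OF g, of x] by simp
    then have "integral {0..x} g * \<psi> x = (LINT y|unit_measure. (if y \<le> x then g y else 0) * \<psi> x)" by simp
    also have "\<dots> = (LINT y|unit_measure. ?F x y)" by (rule Bochner_Integration.integral_cong) auto
    finally show "integral {0..x} g * \<psi> x = (LINT y|unit_measure. ?F x y)" .
  qed
  also have "\<dots> = (LINT y|unit_measure. LINT x|unit_measure. ?F x y)" using fub by simp
  also have "\<dots> = (LINT y|unit_measure. - (g y * \<Psi> y))"
  proof (rule Bochner_Integration.integral_cong[OF refl])
    fix y assume "y \<in> space unit_measure"
    then have y: "0 \<le> y" "y \<le> 1" by auto
    have "(\<psi> has_integral (\<Psi> 1 - \<Psi> y)) {y..1}"
      using y by (intro fundamental_theorem_of_calculus)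
        (auto simp flip: has_real_derivative_iff_has_vector_derivative intro: has_field_derivative_subset[OF \<Psi>])
    then have *: "- \<Psi> y = (LINT x|unit_measure. (if y \<le> x then \<psi> x else 0))"
      using LINT_unit_cutoff(2)[OF continuous_integrable_unit[OF \<psi>] y] \<open>\<Psi> 1 = 0\<close> by (simp add: integral_unique)
    have "- (g y * \<Psi> y) = g y * - \<Psi> y" by simp
    also have "\<dots> = (LINT x|unit_measure. g y * (if y \<le> x then \<psi> x else 0))" unfolding * by simp
    also have "\<dots> = (LINT x|unit_measure. ?F x y)" by (rule Bochner_Integration.integral_cong) auto
    finally show "(LINT x|unit_measure. ?F x y) = - (g y * \<Psi> y)" by simp
  qed
  finally show ?thesis by simp
qed

section \<open>Functions with a weak derivative are primitives\<close>

text \<open>The mean-zero condition makes the primitive vanish to the right of the support.\<close>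

lemma test_function_of_density:
  fixes \<psi> :: "real \<Rightarrow> real"
  assumes ab: "0 < a" "a \<le> b" "b < 1" and cont: "continuous_on UNIV \<psi>"
    and supp: "\<And>x. x \<notin> {a..b} \<Longrightarrow> \<psi> x = 0" and int: "integral {0..1} \<psi> = 0"
  defines "\<phi> \<equiv> \<lambda>x. integral {0..x} \<psi>"
  shows "\<phi> \<in> test_functions" "deriv \<phi> = \<psi>"
    "\<And>x. x \<in> {0..1} \<Longrightarrow> (\<phi> has_real_derivative \<psi> x) (at x within {0..1})" "\<phi> 1 = 0"
proof -
  have \<psi>i: "\<psi> integrable_on {c..d}" for c d
    by (rule integrable_continuous_real) (rule continuous_on_subset[OF cont], simp)
  have left: "\<phi> x = 0" if "x < a" for x
  proof -
    have "integral {0..x} \<psi> = integral {0..x} (\<lambda>x. 0)" using that supp by (intro integral_cong) auto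
    then show ?thesis by (simp add: \<phi>_def)
  qed
  have right: "\<phi> x = 0" if "b < x" for x
  proof -
    have "(\<psi> has_integral integral {a..b} \<psi>) {0..x}"
      by (rule has_integral_on_superset[OF integrable_integral[OF \<psi>i]]) (use supp that ab in auto)
    moreover have "(\<psi> has_integral integral {a..b} \<psi>) {0..1}"
      by (rule has_integral_on_superset[OF integrable_integral[OF \<psi>i]]) (use supp ab in auto)
    ultimately show ?thesis using int by (simp add: \<phi>_def integral_unique)
  qed
  have der: "(\<phi> has_real_derivative \<psi> x) (at x)" for x
  proof (cases "x < a")
    case True
    have "((\<lambda>x. 0) has_real_derivative 0) (at x)" by simp
    moreover have "\<forall>\<^sub>F y in nhds x. 0 = \<phi> y"
      using eventually_nhds_in_open[of "{..<a}" x] True by (auto elim!: eventually_mono simp: left)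
    ultimately have "(\<phi> has_real_derivative 0) (at x)"
      using DERIV_cong_ev[of x x "\<lambda>x. 0" \<phi> 0 0] by simp
    then show ?thesis using True supp[of x] by simp
  next
    case False
    then have x: "0 < x" using ab by simp
    have "(\<phi> has_real_derivative \<psi> x) (at x within {0..x + 1})"
      unfolding \<phi>_def
      by (rule integral_has_real_derivative) (use x in \<open>auto intro: continuous_on_subset[OF cont]\<close>)
    then show ?thesis using x at_within_interior[of x "{0..x + 1}"] by (simp add: interior_atLeastAtMost_real)
  qed
  have c: "closure {x. \<phi> x \<noteq> 0} \<subseteq> {a..b}"
    by (rule closure_minimal) (use left right in \<open>force simp: not_le[symmetric]\<close>, simp)
  have "\<phi> C1_differentiable_on UNIV"
    unfolding C1_differentiable_on_def using der cont
    by (intro exI[of _ \<psi>]) (auto simp: has_real_derivative_iff_has_vector_derivative)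
  moreover have "compact (closure {x. \<phi> x \<noteq> 0})"
    using c by (intro compact_closure[THEN iffD2] bounded_subset[OF bounded_closed_interval[of a b]])
      (meson closure_subset order_trans)
  moreover have "closure {x. \<phi> x \<noteq> 0} \<subseteq> {0<..<1}" using c ab by force
  ultimately show "\<phi> \<in> test_functions" by (simp add: test_functions_def)
  show "deriv \<phi> = \<psi>" using der DERIV_imp_deriv by blast
  show "(\<phi> has_real_derivative \<psi> x) (at x within {0..1})" for x
    using der has_field_derivative_at_within by blast
  show "\<phi> 1 = 0" using right ab by simp
qed

text \<open>A one-sided du Bois-Reymond lemma. If the set where \<open>K > 0\<close> had positive measure, it would
  contain a closed set \<open>T\<close> of positive measure; functions \<open>\<rho> max(0, 1 - n dist(x, T))\<close>, with \<open>\<rho>\<close>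
  a fixed bump that is positive on \<open>T\<close>, decrease to \<open>\<rho>\<close> times the indicator of \<open>T\<close>, so that the
  integral of \<open>K \<rho>\<close> over \<open>T\<close> would be zero.\<close>

lemma AE_nonpos_of_bumps:
  fixes K :: "real \<Rightarrow> real"
  assumes K: "integrable unit_measure K"
    and test: "\<And>a b \<psi>. 0 < a \<Longrightarrow> a \<le> b \<Longrightarrow> b < 1 \<Longrightarrow> continuous_on UNIV \<psi> \<Longrightarrow>
       (\<And>x. x \<notin> {a..b} \<Longrightarrow> \<psi> x = 0) \<Longrightarrow> (LINT x|unit_measure. K x * \<psi> x) = 0"
  shows "AE x in unit_measure. K x \<le> 0"
proof -
  define A where "A = {x \<in> {0<..<1}. 0 < K x}"
  have Km: "K \<in> borel_measurable unit_measure" using K by simp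
  have As: "A \<in> sets lebesgue"
  proof -
    have "{x \<in> space unit_measure. 0 < K x} \<in> sets unit_measure" using Km by measurable
    then show ?thesis by (simp add: A_def sets_restrict_space_iff)
  qed
  have null: "T \<in> null_sets lebesgue" if T: "closed T" "T \<subseteq> A" for T
  proof (cases "T = {}")
    case False
    have Tsub: "T \<subseteq> {0<..<1}" using T(2) by (auto simp: A_def)
    then have "bounded T" by (rule bounded_subset[rotated]) simp
    then have Tc: "compact T" using T(1) by (simp add: compact_eq_bounded_closed)
    obtain p where p: "p \<in> T" "\<And>x. x \<in> T \<Longrightarrow> p \<le> x" using compact_attains_inf[OF Tc False] by blast
    obtain q where q: "q \<in> T" "\<And>x. x \<in> T \<Longrightarrow> x \<le> q" using compact_attains_sup[OF Tc False] by blast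
    define a where "a = p / 2"
    define b where "b = (1 + q) / 2"
    have pq: "0 < p" "p < 1" "0 < q" "q < 1" "p \<le> q" using p q Tsub by auto
    have ab: "0 < a" "a \<le> b" "b < 1" "a < p" "q < b" using pq by (auto simp: a_def b_def)
    define \<rho> where "\<rho> x = max 0 ((x - a) * (b - x))" for x
    have \<rho>0: "0 \<le> \<rho> x" for x by (simp add: \<rho>_def)
    have \<rho>T: "0 < \<rho> x" if "x \<in> T" for x using p(2)[OF that] q(2)[OF that] ab by (auto simp: \<rho>_def less_max_iff_disj)
    have \<rho>out: "\<rho> x = 0" if "x \<notin> {a..b}" for x
    proof -
      have "(x - a) * (b - x) \<le> 0" using that ab by (auto simp: mult_le_0_iff)
      then show ?thesis by (simp add: \<rho>_def)
    qed
    have \<rho>1: "\<rho> x \<le> 1" if "0 < x" "x < 1" for x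
    proof (cases "x \<in> {a..b}")
      case True
      then have "(x - a) * (b - x) \<le> 1 * 1" using that ab by (intro mult_mono) auto
      then show ?thesis by (simp add: \<rho>_def)
    qed (simp add: \<rho>out)
    have \<rho>c: "continuous_on S \<rho>" for S unfolding \<rho>_def by (intro continuous_intros)
    define \<psi> where "\<psi> n x = \<rho> x * max 0 (1 - real n * infdist x T)" for n x
    have \<psi>c: "continuous_on S (\<psi> n)" for n S
      unfolding \<psi>_def by (intro continuous_intros \<rho>c)
    have \<psi>le: "\<bar>\<psi> n x\<bar> \<le> 1" if "0 < x" "x < 1" for n x
    proof -
      have "\<rho> x * max 0 (1 - real n * infdist x T) \<le> 1 * 1"
        using \<rho>1[OF that] \<rho>0 infdist_nonneg[of x T] by (intro mult_mono) auto
      then show ?thesis using \<rho>0[of x] by (simp add: \<psi>_def)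
    qed
    have zero: "(LINT x|unit_measure. K x * \<psi> n x) = 0" for n
      by (rule test[OF ab(1-3) \<psi>c]) (simp add: \<psi>_def \<rho>out)
    let ?F = "\<lambda>x. K x * (\<rho> x * indicat_real T x)"
    have Fm: "?F \<in> borel_measurable unit_measure"
    proof -
      have "T \<in> sets borel" using T(1) by simp
      then have "indicat_real T \<in> borel_measurable unit_measure"
        by (intro measurable_restrict_space1 borel_measurable_indicator) simp
      then show ?thesis
        using Km continuous_measurable_unit[OF \<rho>c] by measurable
    qed
    have lim: "(\<lambda>n. LINT x|unit_measure. K x * \<psi> n x) \<longlonglongrightarrow> (LINT x|unit_measure. ?F x)"
    proof (rule integral_dominated_convergence[where w="\<lambda>x. \<bar>K x\<bar>"])
      show "(\<lambda>x. K x * \<psi> n x) \<in> borel_measurable unit_measure" for n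
        using Km continuous_measurable_unit[OF \<psi>c] by measurable
      show "AE x in unit_measure. norm (K x * \<psi> n x) \<le> \<bar>K x\<bar>" for n
        by (rule AE_unit_measure_all) (use \<psi>le in \<open>auto simp: abs_mult intro: mult_left_le\<close>)
      show "AE x in unit_measure. (\<lambda>n. K x * \<psi> n x) \<longlonglongrightarrow> ?F x"
      proof (rule AE_I2)
        fix x
        show "(\<lambda>n. K x * \<psi> n x) \<longlonglongrightarrow> ?F x"
        proof (cases "x \<in> T")
          case True
          then have "infdist x T = 0" by (simp add: infdist_zero)
          then show ?thesis using True by (simp add: \<psi>_def)
        next
          case out: False
          have pos: "0 < infdist x T" using out T(1) False by (metis in_closed_iff_infdist_zero infdist_nonneg less_eq_real_def)
          obtain N :: nat where N: "1 < real N * infdist x T" using reals_Archimedean3[OF pos] by blast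
          have "\<psi> n x = 0" if "n \<ge> N" for n
          proof -
            have "real N * infdist x T \<le> real n * infdist x T" using that pos by (intro mult_right_mono) auto
            then show ?thesis using N by (simp add: \<psi>_def max_def)
          qed
          then have "\<forall>\<^sub>F n in sequentially. ?F x = K x * \<psi> n x"
            using out by (auto simp: eventually_sequentially intro!: exI[of _ N])
          then show ?thesis by (rule Lim_transform_eventually[OF tendsto_const])
        qed
      qed
    qed (use K Fm in auto)
    have F0: "(LINT x|unit_measure. ?F x) = 0"
      using LIMSEQ_unique[OF lim] zero by simp
    have Fi: "integrable unit_measure ?F"
    proof (rule Bochner_Integration.integrable_bound[OF K Fm])
      show "AE x in unit_measure. norm (?F x) \<le> norm (K x)"
        by (rule AE_unit_measure_all) (use \<rho>0 \<rho>1 in \<open>auto simp: abs_mult indicator_def intro: mult_left_le\<close>)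
    qed
    have Fpos: "0 \<le> ?F x" for x
    proof (cases "x \<in> T")
      case True
      then have "0 \<le> K x" using T(2) by (auto simp: A_def)
      then show ?thesis using \<rho>0[of x] by simp
    qed simp
    have "AE x in unit_measure. ?F x = 0"
      using integral_nonneg_eq_0_iff_AE[OF Fi] Fpos F0 by simp
    then have "AE x in unit_measure. x \<notin> T"
    proof eventually_elim
      fix x assume "?F x = 0"
      then show "x \<notin> T" using \<rho>T[of x] T(2) by (auto simp: A_def)
    qed
    then have "AE x in lebesgue. x \<in> {0<..<1} \<longrightarrow> x \<notin> T"
      by (simp add: AE_restrict_space_iff)
    then have "AE x in lebesgue. x \<notin> T" using Tsub by (auto elim!: eventually_mono)
    then show ?thesis using AE_iff_null_sets[of T lebesgue] T(1) by auto
  qed simp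
  have "A \<in> null_sets lebesgue"
  proof (rule ccontr)
    assume "A \<notin> null_sets lebesgue"
    then have ne: "emeasure lebesgue A \<noteq> 0" using As by auto
    have "emeasure lebesgue A \<le> emeasure lebesgue {0<..<1::real}"
      using As by (intro emeasure_mono) (auto simp: A_def)
    then have fin: "emeasure lebesgue A < \<infinity>" by (auto simp: less_top[symmetric] top_unique)
    then have eq: "emeasure lebesgue A = ennreal (measure lebesgue A)" by (simp add: emeasure_eq_ennreal_measure)
    then have "0 < measure lebesgue A" using ne by (metis ennreal_0 measure_nonneg less_eq_real_def)
    then obtain T where T: "closed T" "T \<subseteq> A" "A - T \<in> lmeasurable" "emeasure lebesgue (A - T) < ennreal (measure lebesgue A)"
      using sets_lebesgue_inner_closed[OF As] by metis
    have "emeasure lebesgue A = emeasure lebesgue (A - T)"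
      using emeasure_Diff_null_set[OF null[OF T(1,2)] As] by simp
    then show False using T(4) eq by simp
  qed
  then have "AE x in lebesgue. x \<notin> A" by (rule AE_not_in)
  then have "AE x in lebesgue. x \<in> {0<..<1} \<longrightarrow> K x \<le> 0"
    by eventually_elim (auto simp: A_def)
  then show ?thesis by (simp add: AE_restrict_space_iff)
qed

text \<open>\<open>K = v - \<integral> g\<close> annihilates all mean-zero densities of test functions. Subtracting from an
  arbitrary bump the multiple of \<open>\<psi>0\<close> with the same integral shows that \<open>K - m\<close>
  annihilates every bump, where \<open>m\<close> is the \<open>\<psi>0\<close>-average of \<open>K\<close>.\<close>

lemma weak_derivative_imp_primitive:
  assumes v: "v \<in> L2" and g: "g \<in> L2" and weak: "v has_weak_derivative g"
  obtains m where "AE x in unit_measure. v x = m + integral {0..x} g"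
proof -
  note vi = L2_integrable[OF v] and gi = L2_integrable[OF g]
  have Gc: "continuous_on {0..1} (\<lambda>x. integral {0..x} g)"
    using indefinite_integral_continuous_1[OF integrable_unit_imp_HK(1)[OF gi]] .
  define K where "K x = v x - integral {0..x} g" for x
  have Ki: "integrable unit_measure K"
    unfolding K_def using vi continuous_integrable_unit[OF Gc] by simp
  have zero: "(LINT x|unit_measure. K x * \<psi> x) = 0"
    if "0 < a" "a \<le> b" "b < 1" "continuous_on UNIV \<psi>" "\<And>x. x \<notin> {a..b} \<Longrightarrow> \<psi> x = 0" "integral {0..1} \<psi> = 0" for a b \<psi>
  proof -
    note t = test_function_of_density[OF that]
    have \<psi>c: "continuous_on {0..1} \<psi>" using that(4) continuous_on_subset by blast
    have "(LINT x|unit_measure. v x * \<psi> x) = - (LINT x|unit_measure. g x * integral {0..x} \<psi>)"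
      using weak t(1,2) unfolding has_weak_derivative_def by metis
    also have "\<dots> = (LINT x|unit_measure. integral {0..x} g * \<psi> x)"
      by (rule integration_by_parts_unit[OF gi \<psi>c t(3,4), symmetric])
    finally show ?thesis
      using integrable_unit_mult_continuous[OF vi \<psi>c]
        integrable_unit_mult_continuous[OF continuous_integrable_unit[OF Gc] \<psi>c]
      by (simp add: K_def left_diff_distrib)
  qed
  define \<psi>0 :: "real \<Rightarrow> real" where "\<psi>0 x = max 0 ((x - 1 / 4) * (3 / 4 - x))" for x
  have \<psi>0c: "continuous_on S \<psi>0" for S unfolding \<psi>0_def by (intro continuous_intros)
  have \<psi>0out: "\<psi>0 x = 0" if "x \<notin> {1/4..3/4}" for x
  proof -
    have "(x - 1 / 4) * (3 / 4 - x) \<le> 0" using that by (auto simp: mult_le_0_iff)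
    then show ?thesis by (simp add: \<psi>0_def)
  qed
  define I where "I = integral {0..1} \<psi>0"
  have "I \<noteq> 0"
  proof
    assume "I = 0"
    then have "\<forall>x\<in>{0..1}. \<psi>0 x = 0"
      using integral_eq_0_iff[of 0 1 \<psi>0] \<psi>0c by (simp add: I_def \<psi>0_def)
    then have "\<psi>0 (1 / 2) = 0" by simp
    then show False by (simp add: \<psi>0_def)
  qed
  define m where "m = (LINT x|unit_measure. K x * \<psi>0 x) / I"
  have ci: "integrable unit_measure (\<lambda>x::real. c)" for c :: real
    by (intro continuous_integrable_unit continuous_intros)
  have test: "(LINT x|unit_measure. (K x - m) * \<psi> x) = 0"
    if ab: "0 < a" "a \<le> b" "b < 1" and \<psi>c: "continuous_on UNIV \<psi>" and out: "\<And>x. x \<notin> {a..b} \<Longrightarrow> \<psi> x = 0" for a b \<psi>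
  proof -
    have \<psi>c': "continuous_on {0..1} \<psi>" using \<psi>c continuous_on_subset by blast
    define J where "J = integral {0..1} \<psi>"
    have i: "\<psi> integrable_on {0..1}" "\<psi>0 integrable_on {0..1}"
      using \<psi>c' \<psi>0c by (auto intro: integrable_continuous_real)
    have "(LINT x|unit_measure. K x * (\<psi> x - J / I * \<psi>0 x)) = 0"
    proof (rule zero[of "min a (1 / 4)" "max b (3 / 4)"])
      have "((\<lambda>x. \<psi> x - J / I * \<psi>0 x) has_integral J - J / I * I) {0..1}"
        unfolding J_def I_def by (intro has_integral_diff has_integral_mult_right integrable_integral i)
      then show "integral {0..1} (\<lambda>x. \<psi> x - J / I * \<psi>0 x) = 0" using \<open>I \<noteq> 0\<close> by (simp add: integral_unique)
      show "\<psi> x - J / I * \<psi>0 x = 0" if "x \<notin> {min a (1 / 4)..max b (3 / 4)}" for x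
      proof -
        have "x \<notin> {a..b}" "x \<notin> {1 / 4..3 / 4}" using that by auto
        then show ?thesis by (simp add: out \<psi>0out)
      qed
    qed (use ab \<open>I \<noteq> 0\<close> in \<open>auto intro!: continuous_intros \<psi>c \<psi>0c\<close>)
    moreover note K\<psi> = integrable_unit_mult_continuous[OF Ki \<psi>c']
    moreover note K\<psi>0 = integrable_unit_mult_continuous[OF Ki \<psi>0c]
    moreover have "(LINT x|unit_measure. K x * (\<psi> x - J / I * \<psi>0 x))
        = (LINT x|unit_measure. K x * \<psi> x) - J / I * (LINT x|unit_measure. K x * \<psi>0 x)"
    proof -
      have "(LINT x|unit_measure. K x * (\<psi> x - J / I * \<psi>0 x))
        = (LINT x|unit_measure. K x * \<psi> x - J / I * (K x * \<psi>0 x))"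
        by (rule Bochner_Integration.integral_cong) (auto simp: algebra_simps)
      then show ?thesis using K\<psi> K\<psi>0 by simp
    qed
    ultimately have "(LINT x|unit_measure. K x * \<psi> x) = m * J" by (simp add: m_def)
    moreover have "(LINT x|unit_measure. \<psi> x) = J"
      using integrable_unit_imp_HK(2)[OF continuous_integrable_unit[OF \<psi>c']] by (simp add: J_def)
    moreover have "(LINT x|unit_measure. (K x - m) * \<psi> x)
        = (LINT x|unit_measure. K x * \<psi> x) - m * (LINT x|unit_measure. \<psi> x)"
      unfolding left_diff_distrib using K\<psi> continuous_integrable_unit[OF \<psi>c'] by simp
    ultimately show ?thesis by simp
  qed
  have "AE x in unit_measure. K x - m \<le> 0"
    by (rule AE_nonpos_of_bumps) (use Ki ci test in auto)
  moreover have "AE x in unit_measure. - (K x - m) \<le> 0"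
  proof (rule AE_nonpos_of_bumps)
    show "integrable unit_measure (\<lambda>x. - (K x - m))" using Ki ci by simp
    show "(LINT x|unit_measure. - (K x - m) * \<psi> x) = 0"
      if "0 < a" "a \<le> b" "b < 1" "continuous_on UNIV \<psi>" "\<And>x. x \<notin> {a..b} \<Longrightarrow> \<psi> x = 0" for a b \<psi>
      unfolding mult_minus_left using test[OF that] by simp
  qed
  ultimately have "AE x in unit_measure. v x = m + integral {0..x} g"
    by eventually_elim (simp add: K_def)
  then show thesis by (rule that)
qed

section \<open>The eigenvalue and the minimisation\<close>

text \<open>On the segment from a point of positivity to an end point, \<open>h\<close> lies above a chord that
  vanishes at most at that end point.\<close>

lemma profile_pos:
  assumes "h \<in> profiles" "0 < x" "x < 1" shows "0 < h x"
proof -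
  have conc: "concave_on {0..1} h" and nonneg: "\<And>y. y \<in> {0..1} \<Longrightarrow> 0 \<le> h y"
    using assms(1) by (auto simp: profiles_def)
  obtain y where y: "y \<in> {0..1}" "h y \<noteq> 0"
    using assms(1) unfolding profiles_def by blast
  then have hy: "0 < h y" using nonneg[of y] by simp
  have chord: "0 < h x" if z: "z \<in> {0..1}" and t: "0 \<le> t" "t < 1" and eq: "x = y + t * (z - y)" for z t
  proof -
    have "0 < (1 - t) * h y + t * h z" using hy t nonneg[OF z] by (intro add_pos_nonneg) auto
    also have "\<dots> \<le> h (y + t * (z - y))"
      using concave_chord_le[OF conc y(1) z, of t] t by (simp add: algebra_simps)
    finally show ?thesis using eq by simp
  qed
  show ?thesis
  proof (cases "x \<le> y")
    case True
    then show ?thesis using chord[of 0 "(y - x) / y"] assms y by (auto simp: field_simps)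
  next
    case False
    then show ?thesis using chord[of 1 "(x - y) / (1 - y)"] assms y by (auto simp: field_simps)
  qed
qed

definition rayleigh_quotients :: "(real \<Rightarrow> real) \<Rightarrow> real set" where
  "rayleigh_quotients h = {(LINT x|unit_measure. (v' x)\<^sup>2 * h x) / (LINT x|unit_measure. (v x)\<^sup>2) | v v'.
     v \<in> H1 \<and> v' \<in> L2 \<and> v has_weak_derivative v' \<and>
     \<not> (AE x in unit_measure. v x = 0) \<and> (LINT x|unit_measure. v x) = 0}"

lemma sigma1_eq_Inf: "sigma1 h = Inf (rayleigh_quotients h)"
  by (simp add: sigma1_def rayleigh_quotients_def)

text \<open>For nonnegative functions gauge integrability is Lebesgue integrability.\<close>

lemma nonneg_integrable_unit:
  fixes f :: "real \<Rightarrow> real"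
  assumes "f integrable_on {0..1}" "\<And>x. 0 < x \<Longrightarrow> x < 1 \<Longrightarrow> 0 \<le> f x"
  shows "integrable unit_measure f"
proof -
  have "f absolutely_integrable_on {0<..<1}"
    using assms by (intro nonnegative_absolutely_integrable_1) (auto simp: integrable_on_open_interval_real)
  then show ?thesis by (simp add: set_integrable_def integrable_restrict_space)
qed

text \<open>With \<open>W = \<integral> V\<close> for the continuous representative \<open>V\<close> of \<open>v\<close>, integration by parts gives
  \<open>\<integral> v\<^sup>2 = - \<integral> v' W\<close>. Young's inequality
  \<open>- 2 v' W \<le> C h v'\<^sup>2 + W\<^sup>2 / (C h)\<close> and the weighted inequality for \<open>W\<close> absorb half of
  \<open>\<integral> v\<^sup>2\<close>.\<close>

lemma rayleigh_quotient_ge: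
  assumes h: "h \<in> profiles" and C: "0 < C" and P: "poincare h C"
    and r: "r \<in> rayleigh_quotients h"
  shows "1 / C \<le> r"
proof -
  obtain v v' where v: "v \<in> H1" and v': "v' \<in> L2" and weak: "v has_weak_derivative v'"
    and nz: "\<not> (AE x in unit_measure. v x = 0)" and mean: "(LINT x|unit_measure. v x) = 0"
    and r: "r = (LINT x|unit_measure. (v' x)\<^sup>2 * h x) / (LINT x|unit_measure. (v x)\<^sup>2)"
    using r unfolding rayleigh_quotients_def by blast
  have v2: "v \<in> L2" using v by (simp add: H1_def)
  have hc: "continuous_on {0..1} h" using h by (simp add: profiles_def)
  have hpos: "0 < h x" if "0 < x" "x < 1" for x using profile_pos[OF h that] .
  obtain m where m: "AE x in unit_measure. v x = m + integral {0..x} v'"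
    using weak_derivative_imp_primitive[OF v2 v' weak] by blast
  note v'i = L2_integrable[OF v']
  let ?G = "\<lambda>x. integral {0..x} v'"
  define V where "V x = m + ?G x" for x
  have Gc: "continuous_on {0..1} ?G"
    using indefinite_integral_continuous_1[OF integrable_unit_imp_HK(1)[OF v'i]] .
  have Vc: "continuous_on {0..1} V" unfolding V_def by (intro continuous_intros Gc)
  have AEV: "AE x in unit_measure. v x = V x" using m by (simp add: V_def)
  have Vm: "V \<in> borel_measurable unit_measure" using continuous_measurable_unit[OF Vc] .
  have vm: "v \<in> borel_measurable unit_measure" using v2 by (simp add: L2_def)
  define W where "W x = integral {0..x} V" for x
  have W': "(W has_real_derivative V x) (at x within {0..1})" if "x \<in> {0..1}" for x
    unfolding W_def by (rule integral_has_real_derivative[OF Vc that])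
  have "(LINT x|unit_measure. V x) = 0"
    using integral_cong_AE[OF vm Vm AEV] mean by simp
  then have W1: "W 1 = 0"
    using integrable_unit_imp_HK(2)[OF continuous_integrable_unit[OF Vc]] by (simp add: W_def)
  have W0: "W 0 = 0" by (simp add: W_def)
  have wV: "vanishing_C1 W V" using W' Vc W0 W1 by (simp add: vanishing_C1_def)
  have Wc: "continuous_on {0..1} W" using W' DERIV_continuous_on by blast
  define N where "N = (LINT x|unit_measure. (V x)\<^sup>2)"
  define A where "A = (LINT x|unit_measure. (v' x)\<^sup>2 * h x)"
  define Q where "Q = (LINT x|unit_measure. (W x)\<^sup>2 / h x)"
  have V2i: "integrable unit_measure (\<lambda>x. (V x)\<^sup>2)"
    by (intro continuous_integrable_unit continuous_intros Vc)
  have N_v: "(LINT x|unit_measure. (v x)\<^sup>2) = N"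
    unfolding N_def using vm Vm AEV by (intro integral_cong_AE) auto
  have Npos: "0 < N"
  proof -
    have "0 \<le> N" unfolding N_def by (rule Bochner_Integration.integral_nonneg) simp
    moreover have "N \<noteq> 0"
    proof
      assume "N = 0"
      then have "AE x in unit_measure. (V x)\<^sup>2 = 0"
        using integral_nonneg_eq_0_iff_AE[OF V2i] by (simp add: N_def)
      then have "AE x in unit_measure. v x = 0" using AEV by eventually_elim simp
      then show False using nz by simp
    qed
    ultimately show ?thesis by simp
  qed
  have "(\<lambda>x. (W x)\<^sup>2 / h x) integrable_on {0..1}"
    and PW: "integral {0..1} (\<lambda>x. (W x)\<^sup>2 / h x) \<le> C * integral {0..1} (\<lambda>x. (V x)\<^sup>2)"
    using P wV unfolding poincare_def by blast+
  then have Qi: "integrable unit_measure (\<lambda>x. (W x)\<^sup>2 / h x)"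
    using hpos by (intro nonneg_integrable_unit) (auto simp: less_imp_le)
  have QN: "Q \<le> C * N"
    using PW integrable_unit_imp_HK(2)[OF Qi] integrable_unit_imp_HK(2)[OF V2i] by (simp add: Q_def N_def)
  have "(\<lambda>x. (v' x)\<^sup>2) \<in> borel_measurable unit_measure" "integrable unit_measure (\<lambda>x. (v' x)\<^sup>2)"
    using v' by (auto simp: L2_def)
  then have Ai: "integrable unit_measure (\<lambda>x. (v' x)\<^sup>2 * h x)"
    using integrable_unit_mult_continuous hc by blast
  have "N = (LINT x|unit_measure. m * V x + ?G x * V x)"
    unfolding N_def by (rule Bochner_Integration.integral_cong) (simp_all add: V_def power2_eq_square algebra_simps)
  also have "\<dots> = m * (LINT x|unit_measure. V x) + (LINT x|unit_measure. ?G x * V x)"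
    using continuous_integrable_unit[OF Vc] integrable_unit_mult_continuous[OF continuous_integrable_unit[OF Gc] Vc]
    by simp
  also have "\<dots> = - (LINT x|unit_measure. v' x * W x)"
    using integration_by_parts_unit[OF v'i Vc W' W1] \<open>(LINT x|unit_measure. V x) = 0\<close> by simp
  also have "\<dots> = (LINT x|unit_measure. - (v' x * W x))" by simp
  also have "\<dots> \<le> (LINT x|unit_measure. C / 2 * ((v' x)\<^sup>2 * h x) + 1 / (2 * C) * ((W x)\<^sup>2 / h x))"
  proof (rule integral_mono)
    show "integrable unit_measure (\<lambda>x. - (v' x * W x))"
      using integrable_unit_mult_continuous[OF v'i Wc] by simp
    show "integrable unit_measure (\<lambda>x. C / 2 * ((v' x)\<^sup>2 * h x) + 1 / (2 * C) * ((W x)\<^sup>2 / h x))"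
      by (intro Bochner_Integration.integrable_add integrable_mult_right Ai Qi)
    fix x assume "x \<in> space unit_measure"
    then have "0 < h x" using hpos by simp
    have "0 \<le> (C * h x * v' x + W x)\<^sup>2 / (2 * C * h x)" using C \<open>0 < h x\<close> by simp
    also have "\<dots> = C / 2 * ((v' x)\<^sup>2 * h x) + 1 / (2 * C) * ((W x)\<^sup>2 / h x) + v' x * W x"
      using C \<open>0 < h x\<close> by (simp add: field_simps power2_eq_square)
    finally show "- (v' x * W x) \<le> C / 2 * ((v' x)\<^sup>2 * h x) + 1 / (2 * C) * ((W x)\<^sup>2 / h x)" by simp
  qed
  also have "\<dots> = C / 2 * A + 1 / (2 * C) * Q" 
    by (subst Bochner_Integration.integral_add)
      (simp_all only: A_def Q_def integral_mult_right_zero integrable_mult_right Ai Qi)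
  also have "\<dots> \<le> C / 2 * A + 1 / (2 * C) * (C * N)" using QN C by (intro add_left_mono mult_left_mono) auto
  also have "\<dots> = C / 2 * A + N / 2" using C by simp
  finally have "N \<le> C * A" by simp
  then have "1 / C \<le> A / N" using Npos C by (simp add: field_simps)
  then show ?thesis by (simp add: r N_v A_def)
qed

lemma C1_has_weak_derivative:
  assumes v: "\<And>x. x \<in> {0..1} \<Longrightarrow> (v has_real_derivative v' x) (at x within {0..1})"
    and v': "continuous_on {0..1} v'"
  shows "v has_weak_derivative v'"
  unfolding has_weak_derivative_def
proof
  fix \<phi> assume \<phi>: "\<phi> \<in> test_functions"
  then obtain D where D: "\<And>x. (\<phi> has_vector_derivative D x) (at x)" "continuous_on UNIV D"
    unfolding test_functions_def C1_differentiable_on_def by auto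
  have der: "(\<phi> has_real_derivative D x) (at x)" for x
    using D(1) by (simp add: has_real_derivative_iff_has_vector_derivative)
  have "deriv \<phi> = D" using der DERIV_imp_deriv by blast
  have Dc: "continuous_on {0..1} D" using D(2) continuous_on_subset by blast
  have \<phi>c: "continuous_on {0..1} \<phi>" using der DERIV_isCont by (blast intro: continuous_at_imp_continuous_on)
  have vc: "continuous_on {0..1} v" using v DERIV_continuous_on by blast
  have "x \<in> {0<..<1}" if "\<phi> x \<noteq> 0" for x
    using \<phi> that closure_subset[of "{x. \<phi> x \<noteq> 0}"] unfolding test_functions_def by auto
  then have ends: "\<phi> 0 = 0" "\<phi> 1 = 0" by force+
  have "((\<lambda>x. v x * D x + v' x * \<phi> x) has_integral (v 1 * \<phi> 1 - v 0 * \<phi> 0)) {0..1}"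
  proof (rule fundamental_theorem_of_calculus)
    fix x :: real assume "x \<in> {0..1}"
    then have "((\<lambda>x. v x * \<phi> x) has_real_derivative v x * D x + v' x * \<phi> x) (at x within {0..1})"
      using DERIV_mult[OF v has_field_derivative_at_within[OF der]] by (simp add: algebra_simps)
    then show "((\<lambda>x. v x * \<phi> x) has_vector_derivative v x * D x + v' x * \<phi> x) (at x within {0..1})"
      by (simp add: has_real_derivative_iff_has_vector_derivative)
  qed simp
  moreover have i: "integrable unit_measure (\<lambda>x. v x * D x)" "integrable unit_measure (\<lambda>x. v' x * \<phi> x)"
    by (intro continuous_integrable_unit continuous_intros vc Dc v' \<phi>c)+
  ultimately have "(LINT x|unit_measure. v x * D x + v' x * \<phi> x) = 0"
    using integrable_unit_imp_HK(2)[of "\<lambda>x. v x * D x + v' x * \<phi> x"] ends by (simp add: integral_unique)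
  then show "(LINT x|unit_measure. v x * deriv \<phi> x) = - (LINT x|unit_measure. v' x * \<phi> x)"
    using i by (simp add: \<open>deriv \<phi> = D\<close>)
qed

lemma C1_rayleigh_quotient:
  assumes v: "\<And>x. x \<in> {0..1} \<Longrightarrow> (v has_real_derivative v' x) (at x within {0..1})"
    and v': "continuous_on {0..1} v'" and h: "continuous_on {0..1} h"
    and mean: "(v has_integral 0) {0..1}"
    and nrm: "((\<lambda>x. (v x)\<^sup>2) has_integral N) {0..1}" "0 < N"
    and energy: "((\<lambda>x. (v' x)\<^sup>2 * h x) has_integral E) {0..1}"
  shows "E / N \<in> rayleigh_quotients h"
proof -
  have vc: "continuous_on {0..1} v" using v DERIV_continuous_on by blast
  have weak: "v has_weak_derivative v'" by (rule C1_has_weak_derivative[OF v v'])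
  have L2: "v \<in> L2" "v' \<in> L2" using vc v' by (auto intro: continuous_in_L2)
  have N: "(LINT x|unit_measure. (v x)\<^sup>2) = N"
    using integrable_unit_imp_HK(2)[OF continuous_integrable_unit[of "\<lambda>x. (v x)\<^sup>2"]] nrm(1) vc
    by (simp add: integral_unique continuous_intros)
  have "(LINT x|unit_measure. (v' x)\<^sup>2 * h x) = E"
    using integrable_unit_imp_HK(2)[OF continuous_integrable_unit[of "\<lambda>x. (v' x)\<^sup>2 * h x"]] energy v' h
    by (simp add: integral_unique continuous_intros)
  moreover have "(LINT x|unit_measure. v x) = 0"
    using integrable_unit_imp_HK(2)[OF continuous_integrable_unit[OF vc]] mean by (simp add: integral_unique)
  moreover have "\<not> (AE x in unit_measure. v x = 0)"
  proof
    assume "AE x in unit_measure. v x = 0"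
    then have "AE x in unit_measure. (v x)\<^sup>2 = 0" by eventually_elim simp
    then have "(LINT x|unit_measure. (v x)\<^sup>2) = 0" by (rule integral_eq_zero_AE)
    then show False using N nrm(2) by simp
  qed
  moreover have "v \<in> H1" using L2 weak by (auto simp: H1_def)
  ultimately show ?thesis
    unfolding rayleigh_quotients_def using L2(2) weak N by blast
qed

text \<open>\<open>f(c x)\<close> is the eigenfunction of \<open>T1\<close>. Its mean is \<open>[x g(c x)] = g c = 0\<close>, and integrating
  \<open>(x g(c x) f(c x))' = f(c x)\<^sup>2 - c x g(c x)\<^sup>2\<close> gives the energy.\<close>

lemma extremal_function_integrals:
  obtains N where "0 < N"
    and "((\<lambda>x. bessel0 (bessel_zero * x)) has_integral 0) {0..1}"
    and "((\<lambda>x. (bessel0 (bessel_zero * x))\<^sup>2) has_integral N) {0..1}"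
    and "((\<lambda>x. (- bessel_zero * bessel1 (bessel_zero * x))\<^sup>2 * (2 * x)) has_integral 2 * bessel_zero * N) {0..1}"
proof -
  define N where "N = integral {0..1} (\<lambda>x. (bessel0 (bessel_zero * x))\<^sup>2)"
  have c: "continuous_on {0..1} (\<lambda>x. (bessel0 (bessel_zero * x))\<^sup>2)" by (intro continuous_intros)
  have hN: "((\<lambda>x. (bessel0 (bessel_zero * x))\<^sup>2) has_integral N) {0..1}"
    unfolding N_def by (rule integrable_integral[OF integrable_continuous_real[OF c]])
  have "0 \<le> N" using has_integral_nonneg[OF hN] by simp
  moreover have "N \<noteq> 0"
  proof
    assume "N = 0"
    then have "\<forall>x\<in>{0..1}. (bessel0 (bessel_zero * x))\<^sup>2 = 0"
      using integral_eq_0_iff[OF c] by (simp add: N_def)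
    then have "(bessel0 (bessel_zero * 0))\<^sup>2 = 0" by (metis atLeastAtMost_iff order_refl zero_le_one)
    then show False by simp
  qed
  ultimately have "0 < N" by simp
  have "((\<lambda>x. bessel0 (bessel_zero * x)) has_integral (1 * bessel1 (bessel_zero * 1) - 0 * bessel1 (bessel_zero * 0))) {0..1}"
    by (rule fundamental_theorem_of_calculus)
      (use DERIV_mult_bessel1_scaled in \<open>auto simp: has_real_derivative_iff_has_vector_derivative\<close>)
  then have mean: "((\<lambda>x. bessel0 (bessel_zero * x)) has_integral 0) {0..1}" by (simp add: bessel_zero(3))
  have "((\<lambda>x. (bessel0 (bessel_zero * x))\<^sup>2 - bessel_zero * x * (bessel1 (bessel_zero * x))\<^sup>2) has_integral
      ((1 * bessel1 (bessel_zero * 1)) * bessel0 (bessel_zero * 1) - (0 * bessel1 (bessel_zero * 0)) * bessel0 (bessel_zero * 0))) {0..1}"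
  proof (rule fundamental_theorem_of_calculus)
    fix x :: real
    have "((\<lambda>x. (x * bessel1 (bessel_zero * x)) * bessel0 (bessel_zero * x)) has_real_derivative
        (bessel0 (bessel_zero * x))\<^sup>2 - bessel_zero * x * (bessel1 (bessel_zero * x))\<^sup>2) (at x within {0..1})"
      by (rule DERIV_cong[OF DERIV_mult[OF DERIV_mult_bessel1_scaled DERIV_bessel0_scaled]]) (simp add: power2_eq_square algebra_simps)
    then show "((\<lambda>x. (x * bessel1 (bessel_zero * x)) * bessel0 (bessel_zero * x)) has_vector_derivative
        (bessel0 (bessel_zero * x))\<^sup>2 - bessel_zero * x * (bessel1 (bessel_zero * x))\<^sup>2) (at x within {0..1})"
      by (simp add: has_real_derivative_iff_has_vector_derivative)
  qed simp
  from has_integral_mult_right[OF has_integral_diff[OF hN this], of "2 * bessel_zero"]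
  have "((\<lambda>x. 2 * bessel_zero * (bessel_zero * x * (bessel1 (bessel_zero * x))\<^sup>2)) has_integral 2 * bessel_zero * N) {0..1}"
    by (simp add: bessel_zero(3))
  then have "((\<lambda>x. (- bessel_zero * bessel1 (bessel_zero * x))\<^sup>2 * (2 * x)) has_integral 2 * bessel_zero * N) {0..1}"
    by (simp add: power2_eq_square algebra_simps)
  then show thesis using that \<open>0 < N\<close> mean hN by blast
qed

lemma extremal_rayleigh_T1:
  assumes "\<And>x. x \<in> {0..1} \<Longrightarrow> h x = T1 x"
  shows "2 * bessel_zero \<in> rayleigh_quotients h"
proof -
  obtain N where N: "0 < N" "((\<lambda>x. bessel0 (bessel_zero * x)) has_integral 0) {0..1}"
    "((\<lambda>x. (bessel0 (bessel_zero * x))\<^sup>2) has_integral N) {0..1}"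
    "((\<lambda>x. (- bessel_zero * bessel1 (bessel_zero * x))\<^sup>2 * (2 * x)) has_integral 2 * bessel_zero * N) {0..1}"
    by (rule extremal_function_integrals)
  have e: "((\<lambda>x. (- bessel_zero * bessel1 (bessel_zero * x))\<^sup>2 * h x) has_integral 2 * bessel_zero * N) {0..1}"
    by (rule has_integral_eq[OF _ N(4)]) (simp add: assms T1_def)
  have "continuous_on {0..1} T1" unfolding T1_def[abs_def] by (intro continuous_intros)
  then have hc: "continuous_on {0..1} h" by (rule continuous_on_eq) (simp add: assms)
  then have "2 * bessel_zero * N / N \<in> rayleigh_quotients h"
    by (intro C1_rayleigh_quotient[OF DERIV_bessel0_scaled _ hc N(2,3,1) e] continuous_intros)
  then show ?thesis using N(1) by simp
qed

lemma extremal_rayleigh_T0: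
  assumes "\<And>x. x \<in> {0..1} \<Longrightarrow> h x = T0 x"
  shows "2 * bessel_zero \<in> rayleigh_quotients h"
proof -
  obtain N where N: "0 < N" "((\<lambda>x. bessel0 (bessel_zero * x)) has_integral 0) {0..1}"
    "((\<lambda>x. (bessel0 (bessel_zero * x))\<^sup>2) has_integral N) {0..1}"
    "((\<lambda>x. (- bessel_zero * bessel1 (bessel_zero * x))\<^sup>2 * (2 * x)) has_integral 2 * bessel_zero * N) {0..1}"
    by (rule extremal_function_integrals)
  note R = N(2-4)[THEN has_integral_reflect_unit, unfolded diff_0_right diff_self]
  have e: "((\<lambda>x. (bessel_zero * bessel1 (bessel_zero * (1 - x)))\<^sup>2 * h x) has_integral 2 * bessel_zero * N) {0..1}"
    by (rule has_integral_eq[OF _ R(3)]) (simp add: assms T0_def)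
  have d: "((\<lambda>x. bessel0 (bessel_zero * (1 - x))) has_real_derivative bessel_zero * bessel1 (bessel_zero * (1 - x))) (at x within {0..1})" for x
    by (rule DERIV_cong[OF DERIV_chain'[OF _ DERIV_bessel0]]) (auto intro!: derivative_eq_intros)
  have "continuous_on {0..1} T0" unfolding T0_def[abs_def] by (intro continuous_intros)
  then have hc: "continuous_on {0..1} h" by (rule continuous_on_eq) (simp add: assms)
  then have "2 * bessel_zero * N / N \<in> rayleigh_quotients h"
    by (intro C1_rayleigh_quotient[OF d _ hc R(1,2) N(1) e] continuous_intros)
  then show ?thesis using N(1) by simp
qed

lemma rayleigh_quotients_nonempty:
  assumes "continuous_on {0..1} h" shows "rayleigh_quotients h \<noteq> {}"
proof -
  obtain N where N: "0 < N" "((\<lambda>x. bessel0 (bessel_zero * x)) has_integral 0) {0..1}"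
    "((\<lambda>x. (bessel0 (bessel_zero * x))\<^sup>2) has_integral N) {0..1}"
    by (rule extremal_function_integrals)
  have c: "continuous_on {0..1} (\<lambda>x. (- bessel_zero * bessel1 (bessel_zero * x))\<^sup>2 * h x)" by (intro continuous_intros assms)
  have "integral {0..1} (\<lambda>x. (- bessel_zero * bessel1 (bessel_zero * x))\<^sup>2 * h x) / N \<in> rayleigh_quotients h"
    by (intro C1_rayleigh_quotient[OF DERIV_bessel0_scaled _ assms N(2,3,1)
          integrable_integral[OF integrable_continuous_real[OF c]]] continuous_intros)
  then show ?thesis by blast
qed

lemma sigma1_ge:
  assumes h: "h \<in> profiles" and "0 < C" "poincare h C"
  shows "1 / C \<le> sigma1 h"
  unfolding sigma1_eq_Inf
proof (rule cInf_greatest)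
  show "rayleigh_quotients h \<noteq> {}" using h by (intro rayleigh_quotients_nonempty) (simp add: profiles_def)
qed (rule rayleigh_quotient_ge[OF assms])

lemma sigma1_le:
  assumes h: "h \<in> profiles" and r: "r \<in> rayleigh_quotients h"
  shows "sigma1 h \<le> r"
  unfolding sigma1_eq_Inf
proof (rule cInf_lower[OF r], rule bdd_belowI)
  fix s assume "s \<in> rayleigh_quotients h"
  then obtain v v' where s: "s = (LINT x|unit_measure. (v' x)\<^sup>2 * h x) / (LINT x|unit_measure. (v x)\<^sup>2)"
    unfolding rayleigh_quotients_def by blast
  show "0 \<le> s"
    unfolding s
  proof (rule divide_nonneg_nonneg)
    show "0 \<le> (LINT x|unit_measure. (v' x)\<^sup>2 * h x)"
      using h by (intro integral_nonneg_AE AE_unit_measure_all) (auto simp: profiles_def)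
  qed (rule Bochner_Integration.integral_nonneg, simp)
qed

text \<open>The eigenfunctions give the upper bound, the weighted inequalities for \<open>T0\<close> and \<open>T1\<close> the
  lower one.\<close>

lemma sigma1_T:
  assumes h: "h \<in> profiles" and T: "(\<forall>x\<in>{0..1}. h x = T0 x) \<or> (\<forall>x\<in>{0..1}. h x = T1 x)"
  shows "sigma1 h = 2 * bessel_zero"
proof (rule antisym)
  show "sigma1 h \<le> 2 * bessel_zero"
    using T extremal_rayleigh_T0[of h] extremal_rayleigh_T1[of h] by (intro sigma1_le[OF h]) blast
  have "poincare h (1 / (2 * bessel_zero))"
    using T
  proof
    assume "\<forall>x\<in>{0..1}. h x = T0 x"
    then show ?thesis by (intro poincare_cong[OF poincare_T0]) (simp add: T0_def)
  next
    assume "\<forall>x\<in>{0..1}. h x = T1 x"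
    then show ?thesis by (intro poincare_cong[OF poincare_T1]) (simp add: T1_def)
  qed
  then show "2 * bessel_zero \<le> sigma1 h" using sigma1_ge[OF h, of "1 / (2 * bessel_zero)"] bessel_zero(1) by simp
qed

lemma sigma1_greater:
  assumes h: "h \<in> profiles1" and T: "\<not> (\<forall>x\<in>{0..1}. h x = T0 x)" "\<not> (\<forall>x\<in>{0..1}. h x = T1 x)"
  shows "2 * bessel_zero < sigma1 h"
proof -
  have hp: "h \<in> profiles" using h by (simp add: profiles1_def)
  then have hc: "continuous_on {0..1} h" "concave_on {0..1} h" "\<And>x. x \<in> {0..1} \<Longrightarrow> 0 \<le> h x"
    by (auto simp: profiles_def)
  have "integral {0..1} h = 1"
    using h integrable_unit_imp_HK(2)[OF continuous_integrable_unit[OF hc(1)]] by (simp add: profiles1_def)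
  then obtain C where C: "C < 1 / (2 * bessel_zero)" "poincare h C" using poincare_strict[OF hc _ T] by blast
  \<comment> \<open>A positive constant is needed to pass to \<open>1 / D\<close>.\<close>
  define D where "D = max C (1 / (4 * bessel_zero))"
  have D: "0 < D" "D < 1 / (2 * bessel_zero)" using C(1) bessel_zero(1) by (auto simp: D_def less_max_iff_disj field_simps)
  have "2 * bessel_zero < 1 / D" using D bessel_zero(1) by (simp add: field_simps)
  also have "\<dots> \<le> sigma1 h"
    by (rule sigma1_ge[OF hp D(1) poincare_mono[OF C(2)]]) (simp add: D_def)
  finally show ?thesis .
qed

lemma T1_in_profiles1: "T1 \<in> profiles1"
proof -
  have c: "continuous_on {0..1} T1" unfolding T1_def[abs_def] by (intro continuous_intros)
  have "concave_on {0..1} T1" by (auto simp: concave_on_iff T1_def algebra_simps)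
  then have p: "T1 \<in> profiles" using c by (auto simp: profiles_def T1_def intro!: bexI[of _ 1])
  have "(T1 has_integral 1) {0..1}"
    using tent_has_integral[of 1] by (rule has_integral_eq[rotated]) (auto simp: tent_def T1_def)
  then show ?thesis
    using p integrable_unit_imp_HK(2)[OF continuous_integrable_unit[OF c]] by (simp add: profiles1_def integral_unique)
qed

theorem theorem1p2:
  shows "(\<exists>h. is_arg_min sigma1 (\<lambda>h. h \<in> profiles1) h) \<and>
    (\<forall>h\<in>profiles1. is_arg_min sigma1 (\<lambda>h. h \<in> profiles1) h \<longleftrightarrow>
       (\<forall>x\<in>{0..1}. h x = T0 x) \<or> (\<forall>x\<in>{0..1}. h x = T1 x))"
proof -
  have p: "h \<in> profiles" if "h \<in> profiles1" for h using that by (simp add: profiles1_def)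
  have ge: "2 * bessel_zero \<le> sigma1 h" if "h \<in> profiles1" for h
    using sigma1_T[OF p[OF that]] sigma1_greater[OF that] by fastforce
  have min: "is_arg_min sigma1 (\<lambda>h. h \<in> profiles1) h \<longleftrightarrow>
      (\<forall>x\<in>{0..1}. h x = T0 x) \<or> (\<forall>x\<in>{0..1}. h x = T1 x)" if h: "h \<in> profiles1" for h
  proof
    assume "is_arg_min sigma1 (\<lambda>h. h \<in> profiles1) h"
    then have "\<not> sigma1 T1 < sigma1 h" using T1_in_profiles1 by (auto simp: is_arg_min_def)
    then have "sigma1 h \<le> 2 * bessel_zero" using sigma1_T[OF p[OF T1_in_profiles1]] by simp
    then show "(\<forall>x\<in>{0..1}. h x = T0 x) \<or> (\<forall>x\<in>{0..1}. h x = T1 x)"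
      using sigma1_greater[OF h] by fastforce
  next
    assume "(\<forall>x\<in>{0..1}. h x = T0 x) \<or> (\<forall>x\<in>{0..1}. h x = T1 x)"
    then have "sigma1 h = 2 * bessel_zero" by (rule sigma1_T[OF p[OF h]])
    then show "is_arg_min sigma1 (\<lambda>h. h \<in> profiles1) h"
      using h ge unfolding is_arg_min_def by (metis not_le)
  qed
  moreover have "is_arg_min sigma1 (\<lambda>h. h \<in> profiles1) T1" using min[OF T1_in_profiles1] by blast
  ultimately show ?thesis by blast
qed

end
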